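(* Let $v,w\in\mathbb{R}^2$ be linearly independent and $\Lambda=\{nv+kw:(n,k)\in\mathbb{Z}^2\}$, with $D(\Lambda)=1/|\det(v,w)|$. Let $g_1,\dots,g_N\in L^2(\mathbb{R})$, let $x_1,\dots,x_N$ be distinct points of $\mathbb{R}^2$, and set $\Lambda_n:=x_n+\Lambda$. \begin{enumerate} \item If $\bigcup_{n=1}^N G(g_n,\Lambda_n)$ is minimal in $L^2(\mathbb{R})$, then it is uniformly minimal and $D(\Lambda)\le 1/N$. \item If $\bigcup_{n=1}^N G(g_n,\Lambda_n)$ is complete in $L^2(\mathbb{R})$, then $D(\Lambda)\ge 1/N$. \end{enumerate}
   Context: For $g\in L^2(\mathbb{R})$ and $(a,b)\in\mathbb{R}^2$ put $g_{ab}(t)=e^{2\pi i b t}g(t-a)$. The Gabor system is $G(g,\Lambda)=\{g_{\lambda\mu}\}_{(\lambda,\mu)\in\Lambda}$. A system is minimal if no element lies in the closed span of the others. It is uniformly minimal if these distances are bounded below by a positive constant. It is complete if its span is dense. *)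

theory Defs
  imports "HOL-Analysis.Analysis"
begin

text \<open>Elements of L2(R) are represented by complex-valued functions on the reals
  that are Borel measurable and square integrable (modulo a.e. equality, which is
  invisible to all notions below since they only use the L2 norm).\<close>

definition L2 :: "(real \<Rightarrow> complex) set" where
  "L2 = {f. f \<in> borel_measurable lborel \<and> integrable lborel (\<lambda>t. (cmod (f t))\<^sup>2)}"

definition l2norm :: "(real \<Rightarrow> complex) \<Rightarrow> real" where
  "l2norm f = sqrt (LINT t|lborel. (cmod (f t))\<^sup>2)"

definition tfshift :: "(real \<Rightarrow> complex) \<Rightarrow> real \<Rightarrow> real \<Rightarrow> (real \<Rightarrow> complex)" where
  "tfshift g a b = (\<lambda>t. cis (2 * pi * b * t) * g (t - a))"

definition fam_span :: "('i \<Rightarrow> real \<Rightarrow> complex) \<Rightarrow> 'i set \<Rightarrow> (real \<Rightarrow> complex) set" where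
  "fam_span e J = {h. \<exists>F c. finite F \<and> F \<subseteq> J \<and> h = (\<lambda>t. \<Sum>j\<in>F. c j * e j t)}"

text \<open>L2 distance of e i to the closed span of the other members
  (equal to the distance to their linear span).\<close>
definition dist_to_others :: "('i \<Rightarrow> real \<Rightarrow> complex) \<Rightarrow> 'i set \<Rightarrow> 'i \<Rightarrow> real" where
  "dist_to_others e I i = (INF h \<in> fam_span e (I - {i}). l2norm (\<lambda>t. e i t - h t))"

definition minimal_sys :: "('i \<Rightarrow> real \<Rightarrow> complex) \<Rightarrow> 'i set \<Rightarrow> bool" where
  "minimal_sys e I \<longleftrightarrow> (\<forall>i\<in>I. dist_to_others e I i > 0)"

definition uniformly_minimal_sys :: "('i \<Rightarrow> real \<Rightarrow> complex) \<Rightarrow> 'i set \<Rightarrow> bool" where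
  "uniformly_minimal_sys e I \<longleftrightarrow> (\<exists>\<delta>>0. \<forall>i\<in>I. dist_to_others e I i \<ge> \<delta>)"

definition complete_sys :: "('i \<Rightarrow> real \<Rightarrow> complex) \<Rightarrow> 'i set \<Rightarrow> bool" where
  "complete_sys e I \<longleftrightarrow>
     (\<forall>f\<in>L2. \<forall>\<epsilon>>0. \<exists>h\<in>fam_span e I. l2norm (\<lambda>t. f t - h t) < \<epsilon>)"

definition det2 :: "real \<times> real \<Rightarrow> real \<times> real \<Rightarrow> real" where
  "det2 v w = fst v * snd w - snd v * fst w"

definition lattice :: "real \<times> real \<Rightarrow> real \<times> real \<Rightarrow> (real \<times> real) set" where
  "lattice v w = {of_int n *\<^sub>R v + of_int k *\<^sub>R w | n k. True}"

definition lattice_density :: "real \<times> real \<Rightarrow> real \<times> real \<Rightarrow> real" where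
  "lattice_density v w = 1 / \<bar>det2 v w\<bar>"

definition union_index :: "nat \<Rightarrow> (nat \<Rightarrow> real \<times> real) \<Rightarrow> (real \<times> real) set
    \<Rightarrow> (nat \<times> (real \<times> real)) set" where
  "union_index N x \<Lambda> = {(n, p). n \<in> {1..N} \<and> p \<in> (\<lambda>q. x n + q) ` \<Lambda>}"

definition union_family :: "(nat \<Rightarrow> real \<Rightarrow> complex) \<Rightarrow> nat \<times> (real \<times> real) \<Rightarrow> real \<Rightarrow> complex" where
  "union_family g = (\<lambda>(n, p). tfshift (g n) (fst p) (snd p))"

end

theory Submission
  imports Defs
begin

text \<open>Both density bounds follow from one comparison: if a uniformly minimal lattice system \<open>E\<close> and a
  complete lattice system \<open>F\<close> are given, then the density of \<open>E\<close>, counted with the number of generators, is at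
  most that of \<open>F\<close>. Indeed, by compactness of a fundamental domain and covariance under lattice shifts,
  every element of \<open>E\<close> is approximated within \<open>\<epsilon>\<close> by a combination of elements of \<open>F\<close> at a bounded distance \<open>R(\<epsilon>)\<close> in
  the time-frequency plane. Hence the elements of \<open>E\<close> in a large parallelogram, which are uniformly far from
  the spans of the others, nearly lie in the span of the elements of \<open>F\<close> in a slightly larger one, and a
  trace argument compares their numbers. One of the two systems is then specialised to the orthonormal basis of the
  functions \<open>exp (2 \<pi> i k t)\<close> on \<open>[m, m + 1)\<close>, which is both uniformly minimal and complete with density \<open>1\<close>;
  its completeness comes from the Stone--Weierstrass theorem on the circle.\<close>

subsection \<open>Geometry of square integrable functions\<close>

text \<open>The two lattices are in general incommensurable: reducing a point of one modulo the
  other may land anywhere in the fundamental domain. Approximating finitely many generators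
  therefore does not suffice, and strong continuity of the shifts together with compactness supplies
  one radius for all residues. The tolerance is \<open>\<eta> * \<delta>\<close>, with
  \<open>\<delta>\<close> the uniform separation, because a dual vector can have norm
  \<open>1 / \<delta>\<close>: the trace then loses only the fraction \<open>\<eta>\<close> of the
  count. The radius depends on \<open>\<eta>\<close> but not on the size \<open>m\<close> of the
  parallelogram, so enlarging the parallelogram costs a boundary term at most linear in
  \<open>m\<close> against an area quadratic in \<open>m\<close>; hence \<open>m\<close> tends to
  infinity before \<open>\<eta>\<close> tends to zero. Functions are not identified when they agree
  almost everywhere, so \<open>l2norm\<close> is only a seminorm; projections onto
  finite-dimensional spans are built by hand and must cope with nonzero functions of norm
  zero.\<close>

lemma L2D:
  assumes "f \<in> L2"
  shows "f \<in> borel_measurable borel" "integrable lborel (\<lambda>t. (cmod (f t))\<^sup>2)"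
  using assms by (auto simp: L2_def)

lemma L2I_bound:
  assumes "f \<in> borel_measurable borel" "integrable lborel u" "\<And>t. (cmod (f t))\<^sup>2 \<le> u t"
  shows "f \<in> L2"
  unfolding L2_def
proof (intro CollectI conjI)
  show "integrable lborel (\<lambda>t. (cmod (f t))\<^sup>2)"
    by (rule Bochner_Integration.integrable_bound[OF assms(2)])
       (use assms in \<open>auto intro!: AE_I2 order.trans[OF _ abs_ge_self]\<close>)
qed (use assms in auto)

lemma L2_zero [simp]: "(\<lambda>t. 0) \<in> L2"
  by (simp add: L2_def)

lemma L2_add [intro, simp]:
  assumes "f \<in> L2" "g \<in> L2"
  shows "(\<lambda>t. f t + g t) \<in> L2"
proof (rule L2I_bound)
  show "integrable lborel (\<lambda>t. 2 * (cmod (f t))\<^sup>2 + 2 * (cmod (g t))\<^sup>2)"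
    using assms by (auto simp: L2_def)
  fix t
  have "(cmod (f t + g t))\<^sup>2 \<le> (cmod (f t) + cmod (g t))\<^sup>2"
    by (intro power_mono norm_triangle_ineq) auto
  also have "\<dots> \<le> 2 * (cmod (f t))\<^sup>2 + 2 * (cmod (g t))\<^sup>2"
    using sum_squares_bound[of "cmod (f t)" "cmod (g t)"] by (simp add: power2_sum)
  finally show "(cmod (f t + g t))\<^sup>2 \<le> 2 * (cmod (f t))\<^sup>2 + 2 * (cmod (g t))\<^sup>2" .
qed (use assms[THEN L2D(1)] in measurable)

lemma L2_cmult [intro, simp]: "f \<in> L2 \<Longrightarrow> (\<lambda>t. c * f t) \<in> L2"
  by (auto simp: L2_def norm_mult power_mult_distrib)

lemma L2_diff [intro, simp]: "f \<in> L2 \<Longrightarrow> g \<in> L2 \<Longrightarrow> (\<lambda>t. f t - g t) \<in> L2"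
  using L2_add[of f "\<lambda>t. (-1) * g t"] L2_cmult[of g "-1"] by simp

lemma L2_sum [intro, simp]: "(\<And>j. j \<in> F \<Longrightarrow> f j \<in> L2) \<Longrightarrow> (\<lambda>t. \<Sum>j\<in>F. f j t) \<in> L2"
  by (induction F rule: infinite_finite_induct) auto

definition l2ip :: "(real \<Rightarrow> complex) \<Rightarrow> (real \<Rightarrow> complex) \<Rightarrow> complex" where
  "l2ip f g = (LINT t|lborel. f t * cnj (g t))"

lemma l2ip_integrable [intro, simp]:
  assumes "f \<in> L2" "g \<in> L2"
  shows "integrable lborel (\<lambda>t. f t * cnj (g t))"
proof (rule Bochner_Integration.integrable_bound)
  show "integrable lborel (\<lambda>t. (cmod (f t))\<^sup>2 + (cmod (g t))\<^sup>2)"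
    using assms by (auto simp: L2_def)
  have "cmod (f t * cnj (g t)) \<le> norm ((cmod (f t))\<^sup>2 + (cmod (g t))\<^sup>2)" for t
  proof -
    have "2 * (cmod (f t) * cmod (g t)) \<le> (cmod (f t))\<^sup>2 + (cmod (g t))\<^sup>2"
      using sum_squares_bound[of "cmod (f t)" "cmod (g t)"] by simp
    moreover have "0 \<le> cmod (f t) * cmod (g t)"
      by simp
    ultimately show ?thesis
      unfolding norm_mult complex_mod_cnj real_norm_def by linarith
  qed
  then show "AE t in lborel. cmod (f t * cnj (g t)) \<le> norm ((cmod (f t))\<^sup>2 + (cmod (g t))\<^sup>2)"
    by simp
  have "f \<in> borel_measurable borel" "g \<in> borel_measurable borel"
    using assms by (auto intro: L2D)
  moreover have "cnj \<in> borel_measurable borel"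
    by (intro borel_measurable_continuous_onI continuous_intros)
  ultimately show "(\<lambda>t. f t * cnj (g t)) \<in> borel_measurable lborel"
    by (auto intro!: borel_measurable_times intro: measurable_compose)
qed

lemma l2ip_add_left [simp]: "f \<in> L2 \<Longrightarrow> g \<in> L2 \<Longrightarrow> h \<in> L2 \<Longrightarrow>
    l2ip (\<lambda>t. f t + g t) h = l2ip f h + l2ip g h"
  unfolding l2ip_def by (simp add: ring_distribs)

lemma l2ip_diff_left [simp]: "f \<in> L2 \<Longrightarrow> g \<in> L2 \<Longrightarrow> h \<in> L2 \<Longrightarrow>
    l2ip (\<lambda>t. f t - g t) h = l2ip f h - l2ip g h"
  unfolding l2ip_def by (simp add: ring_distribs)

lemma l2ip_cmult_left [simp]: "l2ip (\<lambda>t. c * f t) h = c * l2ip f h"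
  unfolding l2ip_def by (simp add: mult.assoc)

lemma l2ip_zero_left [simp]: "l2ip (\<lambda>t. 0) h = 0"
  unfolding l2ip_def by simp

lemma l2ip_sum_left [simp]: "(\<And>j. j \<in> F \<Longrightarrow> f j \<in> L2) \<Longrightarrow> h \<in> L2 \<Longrightarrow>
    l2ip (\<lambda>t. \<Sum>j\<in>F. f j t) h = (\<Sum>j\<in>F. l2ip (f j) h)"
  by (induction F rule: infinite_finite_induct) auto

lemma l2ip_commute: "l2ip f g = cnj (l2ip g f)"
  unfolding l2ip_def by (subst Bochner_Integration.integral_cnj[symmetric]) (simp add: mult.commute)

lemma l2ip_cmult_right [simp]: "l2ip f (\<lambda>t. c * g t) = cnj c * l2ip f g"
  by (subst (1 2) l2ip_commute) simp

lemma l2ip_add_right [simp]: "f \<in> L2 \<Longrightarrow> g \<in> L2 \<Longrightarrow> h \<in> L2 \<Longrightarrow>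
    l2ip h (\<lambda>t. f t + g t) = l2ip h f + l2ip h g"
  by (subst (1 2 3) l2ip_commute) simp

lemma l2ip_diff_right [simp]: "f \<in> L2 \<Longrightarrow> g \<in> L2 \<Longrightarrow> h \<in> L2 \<Longrightarrow>
    l2ip h (\<lambda>t. f t - g t) = l2ip h f - l2ip h g"
  by (subst (1 2 3) l2ip_commute) simp

lemma l2ip_zero_right [simp]: "l2ip h (\<lambda>t. 0) = 0"
  unfolding l2ip_def by simp

lemma l2ip_eq_0_commute: "l2ip f g = 0 \<Longrightarrow> l2ip g f = 0"
  by (subst l2ip_commute) simp

lemma l2norm_nonneg [simp]: "0 \<le> l2norm f"
  by (simp add: l2norm_def)

lemma l2norm_sq: "(l2norm f)\<^sup>2 = (LINT t|lborel. (cmod (f t))\<^sup>2)"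
  by (simp add: l2norm_def)

lemma l2ip_self: "l2ip f f = of_real ((l2norm f)\<^sup>2)"
  unfolding l2ip_def l2norm_sq
  by (simp add: complex_norm_square[symmetric] del: of_real_power)

lemma l2norm_cmult [simp]: "l2norm (\<lambda>t. c * f t) = cmod c * l2norm f"
  by (simp add: l2norm_def norm_mult power_mult_distrib real_sqrt_mult)

lemma l2norm_minus_commute: "l2norm (\<lambda>t. f t - g t) = l2norm (\<lambda>t. g t - f t)"
  by (simp add: l2norm_def norm_minus_commute)

lemma l2norm_add_sq:
  assumes "f \<in> L2" "g \<in> L2"
  shows "(l2norm (\<lambda>t. f t + g t))\<^sup>2 = (l2norm f)\<^sup>2 + 2 * Re (l2ip f g) + (l2norm g)\<^sup>2"
proof -
  have "complex_of_real ((l2norm (\<lambda>t. f t + g t))\<^sup>2) = l2ip f f + l2ip f g + (l2ip g f + l2ip g g)"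
    using assms by (simp add: l2ip_self[symmetric] del: of_real_power)
  also have "l2ip f g + l2ip g f = of_real (2 * Re (l2ip f g))"
    by (subst (2) l2ip_commute) (simp add: complex_add_cnj)
  then have "l2ip f f + l2ip f g + (l2ip g f + l2ip g g)
    = of_real ((l2norm f)\<^sup>2 + 2 * Re (l2ip f g) + (l2norm g)\<^sup>2)"
    by (simp add: l2ip_self add.assoc)
  finally show ?thesis
    by (simp only: of_real_eq_iff)
qed

lemma l2ip_Cauchy_Schwarz:
  assumes "f \<in> L2" "g \<in> L2"
  shows "cmod (l2ip f g) \<le> l2norm f * l2norm g"
proof -
  define c where "c = l2ip f g"
  \<comment> \<open>This expands the squared norm of \<open>f + r c g\<close>. The factor
    \<open>c\<close> makes the cross term real and leaves a quadratic in the real number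
    \<open>r\<close>.\<close>
  have *: "0 \<le> (l2norm f)\<^sup>2 + 2 * r * (cmod c)\<^sup>2 + r\<^sup>2 * (cmod c)\<^sup>2 * (l2norm g)\<^sup>2" for r :: real
  proof -
    have "0 \<le> (l2norm (\<lambda>t. f t + (of_real r * c) * g t))\<^sup>2"
      by simp
    also have "\<dots> = (l2norm f)\<^sup>2 + 2 * Re (of_real r * (cnj c * c)) + (l2norm (\<lambda>t. (of_real r * c) * g t))\<^sup>2"
      using assms by (subst l2norm_add_sq) (simp_all add: c_def mult.assoc)
    also have "cnj c * c = of_real ((cmod c)\<^sup>2)"
      by (metis complex_norm_square mult.commute)
    finally show ?thesis
      by (simp add: norm_mult power_mult_distrib mult.assoc del: of_real_power)
  qed
  have "(cmod c)\<^sup>2 \<le> (l2norm f)\<^sup>2 * (l2norm g)\<^sup>2"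
  proof (cases "l2norm g = 0")
    case True
    show ?thesis
    proof (rule ccontr)
      assume "\<not> ?thesis"
      then have "c \<noteq> 0"
        using True by auto
      \<comment> \<open>With \<open>l2norm g = 0\<close> the bound is affine in \<open>r\<close>,
        and this \<open>r\<close> makes its value -1.\<close>
      then show False
        using *[of "- ((l2norm f)\<^sup>2 + 1) / (2 * (cmod c)\<^sup>2)"] True by (simp add: field_simps)
    qed
  next
    case False
    \<comment> \<open>The value \<open>- 1 / (l2norm g)\<^sup>2\<close> of \<open>r\<close>
      minimises the quadratic.\<close>
    have "0 \<le> (l2norm f)\<^sup>2 - (cmod c)\<^sup>2 / (l2norm g)\<^sup>2"
      using *[of "- 1 / (l2norm g)\<^sup>2"] False by (simp add: field_simps power2_eq_square)
    then show ?thesis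
      using False by (simp add: field_simps)
  qed
  then have "(cmod c)\<^sup>2 \<le> (l2norm f * l2norm g)\<^sup>2"
    by (simp add: power_mult_distrib)
  then show ?thesis
    unfolding c_def by (rule power2_le_imp_le) simp
qed

lemma l2norm_triangle:
  assumes "f \<in> L2" "g \<in> L2"
  shows "l2norm (\<lambda>t. f t + g t) \<le> l2norm f + l2norm g"
proof (rule power2_le_imp_le)
  have "Re (l2ip f g) \<le> l2norm f * l2norm g"
    using l2ip_Cauchy_Schwarz[OF assms] complex_Re_le_cmod order.trans by blast
  then show "(l2norm (\<lambda>t. f t + g t))\<^sup>2 \<le> (l2norm f + l2norm g)\<^sup>2"
    using assms by (simp add: l2norm_add_sq power2_sum)
qed simp

lemma l2norm_triangle_diff:
  assumes "f \<in> L2" "g \<in> L2" "h \<in> L2"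
  shows "l2norm (\<lambda>t. f t - h t) \<le> l2norm (\<lambda>t. f t - g t) + l2norm (\<lambda>t. g t - h t)"
  using l2norm_triangle[of "\<lambda>t. f t - g t" "\<lambda>t. g t - h t"] assms by simp

section \<open>Finite linear combinations and distances to their spans\<close>

lemma fam_spanI: "finite F \<Longrightarrow> F \<subseteq> J \<Longrightarrow> (\<lambda>t. \<Sum>j\<in>F. c j * e j t) \<in> fam_span e J"
  unfolding fam_span_def by blast

lemma fam_span_finite:
  assumes "finite J" "h \<in> fam_span e J"
  obtains c where "h = (\<lambda>t. \<Sum>j\<in>J. c j * e j t)"
proof -
  obtain F c where F: "F \<subseteq> J" "h = (\<lambda>t. \<Sum>j\<in>F. c j * e j t)"
    using assms unfolding fam_span_def by blast
  have "h = (\<lambda>t. \<Sum>j\<in>J. (if j \<in> F then c j else 0) * e j t)"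
    unfolding F(2) using F(1) assms(1) by (intro ext sum.mono_neutral_cong_left) auto
  then show ?thesis
    by (rule that)
qed

lemma fam_span_zero [simp]: "(\<lambda>t. 0) \<in> fam_span e J"
  using fam_spanI[of "{}" J] by simp

lemma fam_span_mono: "J \<subseteq> K \<Longrightarrow> fam_span e J \<subseteq> fam_span e K"
  unfolding fam_span_def by blast

lemma fam_span_base: "j \<in> J \<Longrightarrow> e j \<in> fam_span e J"
  using fam_spanI[of "{j}" J "\<lambda>_. 1" e] by simp

lemma fam_span_cmult:
  assumes "h \<in> fam_span e J"
  shows "(\<lambda>t. d * h t) \<in> fam_span e J"
proof -
  obtain F c where F: "finite F" "F \<subseteq> J" "h = (\<lambda>t. \<Sum>j\<in>F. c j * e j t)"
    using assms unfolding fam_span_def by blast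
  have "(\<lambda>t. d * h t) = (\<lambda>t. \<Sum>j\<in>F. (d * c j) * e j t)"
    by (simp add: F(3) sum_distrib_left mult.assoc)
  then show ?thesis
    using fam_spanI[OF F(1,2)] by simp
qed

lemma fam_span_add:
  assumes "h \<in> fam_span e J" "k \<in> fam_span e J"
  shows "(\<lambda>t. h t + k t) \<in> fam_span e J"
proof -
  obtain F c G d where F: "finite F" "F \<subseteq> J" "h = (\<lambda>t. \<Sum>j\<in>F. c j * e j t)"
    and G: "finite G" "G \<subseteq> J" "k = (\<lambda>t. \<Sum>j\<in>G. d j * e j t)"
    using assms unfolding fam_span_def by blast
  have "h \<in> fam_span e (F \<union> G)" "k \<in> fam_span e (F \<union> G)"
    using F G unfolding fam_span_def by blast+
  then obtain c' d' where "h = (\<lambda>t. \<Sum>j\<in>F \<union> G. c' j * e j t)" "k = (\<lambda>t. \<Sum>j\<in>F \<union> G. d' j * e j t)"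
    using F G by (metis (no_types) fam_span_finite finite_UnI)
  then have "(\<lambda>t. h t + k t) = (\<lambda>t. \<Sum>j\<in>F \<union> G. (c' j + d' j) * e j t)"
    by (simp add: sum.distrib ring_distribs)
  then show ?thesis
    using fam_spanI[of "F \<union> G" J "\<lambda>j. c' j + d' j" e] F G by auto
qed

lemma fam_span_diff: "h \<in> fam_span e J \<Longrightarrow> k \<in> fam_span e J \<Longrightarrow> (\<lambda>t. h t - k t) \<in> fam_span e J"
  using fam_span_add[of h e J "\<lambda>t. (-1) * k t"] fam_span_cmult[of k e J "-1"] by simp

lemma fam_span_sum:
  "(\<And>i. i \<in> S \<Longrightarrow> h i \<in> fam_span e J) \<Longrightarrow> (\<lambda>t. \<Sum>i\<in>S. h i t) \<in> fam_span e J"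
  by (induction S rule: infinite_finite_induct) (auto intro: fam_span_add)

lemmas fam_span_intros = fam_span_zero fam_span_add fam_span_diff fam_span_cmult fam_span_sum

text \<open>Scalars are put into the base case, so a property only has to be additive; closure under
  scalar multiplication never becomes a separate obligation.\<close>

lemma fam_span_induct [consumes 1, case_names zero add base]:
  assumes "h \<in> fam_span e J"
    and "P (\<lambda>t. 0)"
    and "\<And>h k. P h \<Longrightarrow> P k \<Longrightarrow> P (\<lambda>t. h t + k t)"
    and "\<And>c j. j \<in> J \<Longrightarrow> P (\<lambda>t. c * e j t)"
  shows "P h"
proof -
  obtain F c where F: "finite F" "F \<subseteq> J" "h = (\<lambda>t. \<Sum>j\<in>F. c j * e j t)"
    using assms(1) unfolding fam_span_def by blast
  have "P (\<lambda>t. \<Sum>j\<in>F. c j * e j t)"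
    using F(1,2)
  proof (induction F rule: finite_induct)
    case (insert j F)
    then show ?case
      using assms(3)[OF assms(4)[of j "c j"]] by simp
  qed (use assms(2) in simp)
  then show ?thesis
    using F(3) by simp
qed

lemma fam_span_L2:
  assumes "h \<in> fam_span e J" "\<And>j. j \<in> J \<Longrightarrow> e j \<in> L2"
  shows "h \<in> L2"
  using assms(1) by (induction rule: fam_span_induct) (use assms(2) in auto)

lemma fam_span_orthogonal:
  assumes "h \<in> fam_span e J" "\<And>j. j \<in> J \<Longrightarrow> e j \<in> L2" "x \<in> L2" "\<And>j. j \<in> J \<Longrightarrow> l2ip x (e j) = 0"
  shows "l2ip h x = 0"
proof -
  have "h \<in> L2 \<and> l2ip h x = 0"
    using assms(1) by (induction rule: fam_span_induct) (use assms(2,3) l2ip_eq_0_commute[OF assms(4)] in auto)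
  then show ?thesis ..
qed

lemma dist_to_others_le:
  assumes "h \<in> fam_span e (I - {i})"
  shows "dist_to_others e I i \<le> l2norm (\<lambda>t. e i t - h t)"
  unfolding dist_to_others_def
  by (rule cINF_lower[OF _ assms]) (auto intro!: bdd_belowI[of _ 0])

lemma dist_to_others_ge:
  assumes "\<And>h. h \<in> fam_span e (I - {i}) \<Longrightarrow> \<delta> \<le> l2norm (\<lambda>t. e i t - h t)"
  shows "\<delta> \<le> dist_to_others e I i"
  unfolding dist_to_others_def
  by (rule cINF_greatest) (use assms fam_span_zero in blast)+

section \<open>Finite-dimensional projections and the trace inequality\<close>

text \<open>One step of the induction projects both \<open>x\<close> and the new vector onto the old
  span and adds the component of the residual of \<open>x\<close> along the residual
  \<open>u\<close> of the new vector. As the \<open>e i\<close> may be dependent, \<open>u\<close>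
  may have norm zero.\<close>

lemma orthogonal_projection_exists:
  assumes "finite A" "\<And>i. i \<in> A \<Longrightarrow> e i \<in> L2" "x \<in> L2"
  shows "\<exists>p\<in>fam_span e A. \<forall>i\<in>A. l2ip (\<lambda>t. x t - p t) (e i) = 0"
  using assms
proof (induction A arbitrary: x rule: finite_induct)
  case empty
  show ?case
    using fam_span_zero by blast
next
  case (insert k A)
  have eL2: "e i \<in> L2" if "i \<in> insert k A" for i
    using insert.prems(1) that .
  obtain p where p: "p \<in> fam_span e A" "\<forall>i\<in>A. l2ip (\<lambda>t. x t - p t) (e i) = 0"
    using insert.IH[OF _ insert.prems(2)] insert.prems(1) by auto
  obtain q where q: "q \<in> fam_span e A" "\<forall>i\<in>A. l2ip (\<lambda>t. e k t - q t) (e i) = 0"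
    using insert.IH[of "e k"] insert.prems(1) by auto
  have sub: "fam_span e A \<subseteq> fam_span e (insert k A)"
    by (rule fam_span_mono) auto
  have L: "p \<in> L2" "q \<in> L2" "e k \<in> L2" "x \<in> L2"
    using fam_span_L2[OF p(1)] fam_span_L2[OF q(1)] eL2 insert.prems(2) by auto
  define u where "u = (\<lambda>t. e k t - q t)"
  have u: "u \<in> L2" "u \<in> fam_span e (insert k A)" "\<forall>i\<in>A. l2ip u (e i) = 0"
    using L q sub unfolding u_def by (auto intro!: fam_span_diff intro: fam_span_base)
  have uq: "l2ip q u = 0"
    by (rule fam_span_orthogonal[OF q(1)]) (use eL2 u in auto)
  have xpq: "l2ip q (\<lambda>t. x t - p t) = 0"
    by (rule fam_span_orthogonal[OF q(1)])
       (use eL2 L p(2) in \<open>auto simp del: l2ip_diff_left\<close>)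
  have uk: "l2ip u (e k) = l2ip u u"
  proof -
    have "l2ip u (e k) = l2ip u (\<lambda>t. u t + q t)"
      by (simp add: u_def)
    also have "\<dots> = l2ip u u"
      using uq u L by (simp add: l2ip_commute[of u q])
    finally show ?thesis .
  qed
  have xk: "l2ip (\<lambda>t. x t - p t) (e k) = l2ip (\<lambda>t. x t - p t) u"
  proof -
    have "l2ip (\<lambda>t. x t - p t) (e k) = l2ip (\<lambda>t. x t - p t) (\<lambda>t. u t + q t)"
      by (simp add: u_def)
    also have "\<dots> = l2ip (\<lambda>t. x t - p t) u + l2ip (\<lambda>t. x t - p t) q"
      using u L by (subst l2ip_add_right) auto
    also have "l2ip (\<lambda>t. x t - p t) q = 0"
      using xpq by (subst l2ip_commute) simp
    finally show ?thesis by simp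
  qed
  define d where "d = l2ip (\<lambda>t. x t - p t) u / l2ip u u"
  define r where "r = (\<lambda>t. p t + d * u t)"
  \<comment> \<open>If \<open>u\<close> has norm zero then \<open>d\<close> is 0 by the convention
    for division, and Cauchy-Schwarz makes the right-hand side vanish too.\<close>
  have dd: "d * l2ip u u = l2ip (\<lambda>t. x t - p t) u"
  proof (cases "l2ip u u = 0")
    case True
    then have "l2norm u = 0"
      by (simp add: l2ip_self)
    then have "l2ip (\<lambda>t. x t - p t) u = 0"
      using l2ip_Cauchy_Schwarz[of "\<lambda>t. x t - p t" u] u L by simp
    then show ?thesis
      using True by simp
  qed (simp add: d_def)
  have r: "l2ip (\<lambda>t. x t - r t) y = l2ip (\<lambda>t. x t - p t) y - d * l2ip u y" if "y \<in> L2" for y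
  proof -
    have "(\<lambda>t. x t - r t) = (\<lambda>t. (x t - p t) - d * u t)"
      by (simp add: r_def algebra_simps)
    then show ?thesis
      using that u L l2ip_diff_left[of "\<lambda>t. x t - p t" "\<lambda>t. d * u t" y] by simp
  qed
  have "r \<in> fam_span e (insert k A)"
    unfolding r_def using p(1) sub u(2) by (intro fam_span_intros) auto
  moreover have "l2ip (\<lambda>t. x t - r t) (e i) = 0" if "i \<in> insert k A" for i
  proof (cases "i = k")
    case True
    then show ?thesis
      using r[OF eL2[OF that]] dd uk xk by simp
  next
    case False
    then have "i \<in> A"
      using that by simp
    then show ?thesis
      using r[OF eL2[OF that]] p(2) u(3) by simp
  qed
  ultimately show ?case
    by blast
qed

text \<open>Zero vectors are allowed in the orthonormal system, which may thus keep the index set.\<close>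
lemma Gram_Schmidt:
  assumes "finite B" "\<forall>j\<in>B. f j \<in> L2"
  shows "\<exists>w. (\<forall>j\<in>B. w j \<in> fam_span f B \<and> l2norm (w j) \<le> 1) \<and>
     (\<forall>j\<in>B. \<forall>k\<in>B. j \<noteq> k \<longrightarrow> l2ip (w j) (w k) = 0) \<and>
     (\<forall>j\<in>B. \<forall>x\<in>L2. l2ip x (w j) * (l2ip (w j) (w j)) = l2ip x (w j)) \<and>
     (\<forall>x\<in>L2. (\<forall>j\<in>B. l2ip x (w j) = 0) \<longrightarrow> (\<forall>j\<in>B. l2ip x (f j) = 0))"
  using assms
proof (induction B rule: finite_induct)
  case empty
  then show ?case by simp
next
  case (insert k B)
  have fL2: "f j \<in> L2" if "j \<in> insert k B" for j
    using insert.prems that by blast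
  obtain w where w: "\<forall>j\<in>B. w j \<in> fam_span f B \<and> l2norm (w j) \<le> 1"
    "\<forall>j\<in>B. \<forall>k\<in>B. j \<noteq> k \<longrightarrow> l2ip (w j) (w k) = 0"
    "\<forall>j\<in>B. \<forall>x\<in>L2. l2ip x (w j) * l2ip (w j) (w j) = l2ip x (w j)"
    "\<forall>x\<in>L2. (\<forall>j\<in>B. l2ip x (w j) = 0) \<longrightarrow> (\<forall>j\<in>B. l2ip x (f j) = 0)"
    using insert.IH insert.prems by auto
  obtain q where q: "q \<in> fam_span f B" "\<forall>i\<in>B. l2ip (\<lambda>t. f k t - q t) (f i) = 0"
    using orthogonal_projection_exists[of B f "f k"] insert.hyps insert.prems by auto
  have sub: "fam_span f B \<subseteq> fam_span f (insert k B)"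
    by (rule fam_span_mono) auto
  have qL2: "q \<in> L2"
    using fam_span_L2[OF q(1)] fL2 by auto
  define u where "u = (\<lambda>t. f k t - q t)"
  have u: "u \<in> L2" "u \<in> fam_span f (insert k B)" "\<forall>i\<in>B. l2ip u (f i) = 0"
    using qL2 fL2 q sub unfolding u_def by (auto intro!: fam_span_diff intro: fam_span_base)
  \<comment> \<open>Since \<open>inverse 0 = 0\<close>, a residual of norm zero is turned into the
    zero function.\<close>
  define v where "v = (\<lambda>t. of_real (inverse (l2norm u)) * u t)"
  have v: "v \<in> L2" "v \<in> fam_span f (insert k B)"
    unfolding v_def using u by (auto intro: fam_span_cmult)
  have nv: "l2norm v = (if l2norm u = 0 then 0 else 1)"
    by (simp add: v_def norm_inverse)
  \<comment> \<open>Both a vector of norm one and the zero function satisfy this identity; it stands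
    in for normalisation, which dependent vectors rule out.\<close>
  have vv: "l2ip x v * l2ip v v = l2ip x v" if "x \<in> L2" for x
  proof (cases "l2norm u = 0")
    case True
    then show ?thesis
      by (simp add: v_def)
  next
    case False
    then show ?thesis
      using nv by (simp add: l2ip_self)
  qed
  have wv: "l2ip (w j) v = 0" if "j \<in> B" for j
    using w(1) that v fL2 u
    by (intro fam_span_orthogonal[of "w j" f B]) (auto simp: v_def)
  have wL2: "w j \<in> L2" if "j \<in> B" for j
    using w(1) that fL2 fam_span_L2[of "w j" f B] by blast
  have *: "l2ip x (f j) = 0"
    if x: "x \<in> L2" "\<forall>j\<in>insert k B. l2ip x ((w(k := v)) j) = 0" and j: "j \<in> insert k B" for x j
  proof -
    have x0: "l2ip x (w j) = 0" if "j \<in> B" for j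
      using x(2) insert.hyps that by (metis fun_upd_other insertCI)
    have x1: "l2ip x v = 0"
      using x(2) by simp
    have xB: "\<forall>j\<in>B. l2ip x (f j) = 0"
      using w(4) x(1) x0 by blast
    have "l2ip q x = 0"
      by (rule fam_span_orthogonal[OF q(1)]) (use fL2 xB x(1) in auto)
    moreover have "l2ip x u = 0"
    proof (cases "l2norm u = 0")
      case True
      then show ?thesis
        using l2ip_Cauchy_Schwarz[OF x(1) u(1)] by simp
    next
      case False
      then show ?thesis
        using x1 by (simp add: v_def)
    qed
    ultimately have "l2ip x (f k) = 0"
      using l2ip_add_right[of u q x] u(1) qL2 x(1) by (simp add: l2ip_commute[of x q] u_def)
    then show ?thesis
      using xB j by blast
  qed
  show ?case
  proof (intro exI[of _ "w(k := v)"] conjI ballI impI)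
    fix j assume j: "j \<in> insert k B"
    show "(w(k := v)) j \<in> fam_span f (insert k B)" "l2norm ((w(k := v)) j) \<le> 1"
      using w(1) j v(2) nv sub by auto
    show "l2ip x ((w(k := v)) j) * l2ip ((w(k := v)) j) ((w(k := v)) j) = l2ip x ((w(k := v)) j)"
      if "x \<in> L2" for x
    proof (cases "j = k")
      case True
      then show ?thesis
        using vv[OF that] by simp
    next
      case False
      then have "l2ip x (w j) * l2ip (w j) (w j) = l2ip x (w j)"
        using w(3) that j by blast
      then show ?thesis
        using False by simp
    qed
    show "l2ip ((w(k := v)) j) ((w(k := v)) i) = 0" if "i \<in> insert k B" "j \<noteq> i" for i
      using that w(2) j wv l2ip_eq_0_commute[OF wv] by (cases "j = k"; cases "i = k") simp_all
  next
    show "l2ip x (f j) = 0"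
      if "x \<in> L2" "\<forall>j\<in>insert k B. l2ip x ((w(k := v)) j) = 0" "j \<in> insert k B" for x j
      using * that by blast
  qed
qed

text \<open>Write \<open>V\<close> and \<open>W\<close> for the spans of \<open>e\<close> and \<open>f\<close>, and let \<open>h\<close> be the basis of \<open>V\<close> dual to \<open>e\<close>. The trace of
  \<open>P\<^sub>V P\<^sub>W\<close> is \<open>\<Sum>\<^sub>i \<langle>P\<^sub>W e\<^sub>i, h\<^sub>i\<rangle>\<close>, which is nearly \<open>card A\<close>, and it is at most \<open>dim W\<close>.\<close>
lemma card_le_of_approx:
  fixes e :: "'i \<Rightarrow> real \<Rightarrow> complex" and f :: "'j \<Rightarrow> real \<Rightarrow> complex"
  assumes A: "finite A" "\<And>i. i \<in> A \<Longrightarrow> e i \<in> L2"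
    and B: "finite B" "\<And>j. j \<in> B \<Longrightarrow> f j \<in> L2"
    and \<delta>: "\<delta> > 0" "\<And>i. i \<in> A \<Longrightarrow> \<delta> \<le> dist_to_others e A i"
    and ap: "\<And>i. i \<in> A \<Longrightarrow> \<exists>u\<in>fam_span f B. l2norm (\<lambda>t. e i t - u t) \<le> \<eta>"
  shows "real (card A) * (1 - \<eta> / \<delta>) \<le> real (card B)"
proof -
  have "\<exists>h\<in>fam_span e A. l2ip (e i) h = 1 \<and> (\<forall>k\<in>A. k \<noteq> i \<longrightarrow> l2ip (e k) h = 0) \<and> l2norm h \<le> 1 / \<delta>"
    if i: "i \<in> A" for i
  proof -
    obtain p where p: "p \<in> fam_span e (A - {i})" "\<forall>k\<in>A - {i}. l2ip (\<lambda>t. e i t - p t) (e k) = 0"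
      using orthogonal_projection_exists[of "A - {i}" e "e i"] A i by auto
    \<comment> \<open>The part of \<open>e i\<close> orthogonal to the other vectors. Divided by its
      squared norm it becomes the dual vector, of norm \<open>1 / l2norm u\<close>.\<close>
    define u where "u = (\<lambda>t. e i t - p t)"
    have pL2: "p \<in> L2"
      by (rule fam_span_L2[OF p(1)]) (use A in auto)
    have psp: "p \<in> fam_span e A"
      using p(1) fam_span_mono[of "A - {i}" A e] by auto
    have u: "u \<in> L2" "u \<in> fam_span e A" "\<forall>k\<in>A - {i}. l2ip u (e k) = 0"
      using A i p pL2 psp unfolding u_def by (auto intro!: fam_span_diff intro: fam_span_base)
    have nu: "\<delta> \<le> l2norm u"
      using \<delta>(2)[OF i] dist_to_others_le[OF p(1)] unfolding u_def by linarith
    have "l2ip p u = 0"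
      by (rule fam_span_orthogonal[OF p(1)]) (use A u in auto)
    then have eu: "l2ip (e i) u = of_real ((l2norm u)\<^sup>2)"
      using l2ip_add_left[of u p u] u(1) pL2 by (simp add: u_def l2ip_self)
    define a where "a = complex_of_real (1 / (l2norm u)\<^sup>2)"
    have a: "a * of_real ((l2norm u)\<^sup>2) = 1" "cmod a * l2norm u = 1 / l2norm u"
      using nu \<delta>(1) by (auto simp: a_def power2_eq_square norm_divide norm_mult)
    have ca: "cnj a = a"
      by (simp add: a_def)
    show ?thesis
    proof (intro bexI conjI ballI impI)
      show "(\<lambda>t. a * u t) \<in> fam_span e A"
        using u(2) by (rule fam_span_cmult)
      show "l2ip (e i) (\<lambda>t. a * u t) = 1"
        using a(1) ca by (simp add: eu del: of_real_power)
      show "l2ip (e k) (\<lambda>t. a * u t) = 0" if "k \<in> A" "k \<noteq> i" for k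
        using l2ip_eq_0_commute[of u "e k"] u(3) that by simp
      have "l2norm (\<lambda>t. a * u t) = 1 / l2norm u"
        using a(2) by simp
      also have "\<dots> \<le> 1 / \<delta>"
        using nu \<delta>(1) by (simp add: frac_le)
      finally show "l2norm (\<lambda>t. a * u t) \<le> 1 / \<delta>" .
    qed
  qed
  then obtain h where h: "\<And>i. i \<in> A \<Longrightarrow> h i \<in> fam_span e A" "\<And>i. i \<in> A \<Longrightarrow> l2ip (e i) (h i) = 1"
    "\<And>i k. i \<in> A \<Longrightarrow> k \<in> A \<Longrightarrow> k \<noteq> i \<Longrightarrow> l2ip (e k) (h i) = 0"
    "\<And>i. i \<in> A \<Longrightarrow> l2norm (h i) \<le> 1 / \<delta>"
    by metis
  have hL2: "h i \<in> L2" if "i \<in> A" for i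
    using fam_span_L2[OF h(1)] A that by blast
  have fB: "\<forall>j\<in>B. f j \<in> L2"
    using B(2) by blast
  obtain w where w: "\<forall>j\<in>B. w j \<in> fam_span f B \<and> l2norm (w j) \<le> 1"
    "\<forall>j\<in>B. \<forall>k\<in>B. j \<noteq> k \<longrightarrow> l2ip (w j) (w k) = 0"
    "\<forall>j\<in>B. \<forall>x\<in>L2. l2ip x (w j) * l2ip (w j) (w j) = l2ip x (w j)"
    "\<forall>x\<in>L2. (\<forall>j\<in>B. l2ip x (w j) = 0) \<longrightarrow> (\<forall>j\<in>B. l2ip x (f j) = 0)"
    using Gram_Schmidt[OF B(1) fB] by (elim exE conjE) (rule that)
  have wL2: "w j \<in> L2" if "j \<in> B" for j
    using w(1) that B fam_span_L2[of "w j" f B] by blast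
  \<comment> \<open>The orthogonal projection onto the span of \<open>f\<close>, written in the
    system \<open>w\<close>; zero members of \<open>w\<close> contribute nothing.\<close>
  define T where "T = (\<lambda>x t. \<Sum>j\<in>B. l2ip x (w j) * w j t)"
  have TL2: "T x \<in> L2" for x
    unfolding T_def using wL2 by auto
  have Tsp: "T x \<in> fam_span f B" for x
    unfolding T_def using w(1) by (intro fam_span_intros) blast
  have Torth: "l2ip (\<lambda>t. x t - T x t) (w k) = 0" if "x \<in> L2" "k \<in> B" for x k
  proof -
    have "l2ip (T x) (w k) = (\<Sum>j\<in>B. l2ip x (w j) * l2ip (w j) (w k))"
      unfolding T_def using wL2 that by simp
    also have "\<dots> = (\<Sum>j\<in>B. if j = k then l2ip x (w k) * l2ip (w k) (w k) else 0)"
      using w(2) that by (intro sum.cong) auto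
    also have "\<dots> = l2ip x (w k)"
      using B(1) bspec[OF bspec[OF w(3) that(2)] that(1)] that(2) by simp
    finally show ?thesis
      using that wL2 TL2 by simp
  qed
  \<comment> \<open>By Pythagoras the projection is at least as close to \<open>e i\<close> as the
    given approximation \<open>u\<close>.\<close>
  have Tle: "l2norm (\<lambda>t. e i t - T (e i) t) \<le> \<eta>" if i: "i \<in> A" for i
  proof -
    obtain u where u: "u \<in> fam_span f B" "l2norm (\<lambda>t. e i t - u t) \<le> \<eta>"
      using ap[OF i] by blast
    let ?a = "\<lambda>t. e i t - T (e i) t" and ?b = "\<lambda>t. T (e i) t - u t"
    have L: "?a \<in> L2" "?b \<in> L2" "?b \<in> fam_span f B"
      using fam_span_L2[OF u(1)] B A i TL2 Tsp u(1) by (auto intro: fam_span_diff)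
    have "\<forall>j\<in>B. l2ip ?a (f j) = 0"
      using w(4) L(1) Torth A i by blast
    then have "l2ip ?b ?a = 0"
      using L B by (intro fam_span_orthogonal[OF L(3)])
         (auto simp del: l2ip_diff_left)
    then have "(l2norm (\<lambda>t. ?a t + ?b t))\<^sup>2 = (l2norm ?a)\<^sup>2 + (l2norm ?b)\<^sup>2"
      using l2norm_add_sq[OF L(1,2)] l2ip_commute[of ?a ?b] by simp
    then have "(l2norm ?a)\<^sup>2 \<le> (l2norm (\<lambda>t. e i t - u t))\<^sup>2"
      by simp
    then have "l2norm ?a \<le> l2norm (\<lambda>t. e i t - u t)"
      by (rule power2_le_imp_le) simp
    then show ?thesis
      using u(2) by linarith
  qed
  \<comment> \<open>The coefficients in \<open>e\<close> of the projection \<open>p\<close> of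
    \<open>w j\<close> are the products of \<open>w j\<close> with the dual vectors, so the sum is
    the squared norm of \<open>p\<close>, at most that of \<open>w j\<close>.\<close>
  have tr: "Re (\<Sum>i\<in>A. l2ip (e i) (w j) * l2ip (w j) (h i)) \<le> 1" if j: "j \<in> B" for j
  proof -
    obtain p where p: "p \<in> fam_span e A" "\<forall>i\<in>A. l2ip (\<lambda>t. w j t - p t) (e i) = 0"
      using orthogonal_projection_exists[of A e "w j"] A wL2[OF j] by auto
    obtain c where c: "p = (\<lambda>t. \<Sum>i\<in>A. c i * e i t)"
      using fam_span_finite[OF A(1) p(1)] .
    let ?r = "\<lambda>t. w j t - p t"
    have pL2: "p \<in> L2" and rL2: "?r \<in> L2"
      using fam_span_L2[OF p(1)] A wL2[OF j] by auto
    have orth: "l2ip y ?r = 0" if "y \<in> fam_span e A" for y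
      by (rule fam_span_orthogonal[OF that])
        (use A p(2) rL2 in \<open>auto simp del: l2ip_diff_left\<close>)
    have "l2ip (w j) (h i) = c i" if i: "i \<in> A" for i
    proof -
      have "l2ip ?r (h i) = 0"
        using orth[OF h(1)[OF i]] l2ip_commute[of ?r "h i"] by simp
      then have "l2ip (w j) (h i) = l2ip p (h i)"
        using wL2[OF j] pL2 hL2[OF i] by simp
      also have "\<dots> = (\<Sum>k\<in>A. c k * l2ip (e k) (h i))"
        unfolding c using A hL2[OF i] by simp
      also have "\<dots> = (\<Sum>k\<in>A. if k = i then c i else 0)"
        using h i by (intro sum.cong) auto
      finally show ?thesis
        using A i by simp
    qed
    then have "(\<Sum>i\<in>A. l2ip (e i) (w j) * l2ip (w j) (h i)) = l2ip p (w j)"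
      unfolding c using A wL2[OF j] by (simp add: mult.commute)
    also have "\<dots> = l2ip p p"
      using orth[OF p(1)] pL2 wL2[OF j] by simp
    finally have "Re (\<Sum>i\<in>A. l2ip (e i) (w j) * l2ip (w j) (h i)) = (l2norm p)\<^sup>2"
      by (simp add: l2ip_self)
    also have "\<dots> \<le> (l2norm (w j))\<^sup>2"
      using l2norm_add_sq[OF pL2 rL2] orth[OF p(1)] by simp
    also have "\<dots> \<le> 1"
      using w(1) j by (simp add: power_le_one)
    finally show ?thesis .
  qed
  have "real (card A) = Re (\<Sum>i\<in>A. l2ip (e i) (h i))"
    using h(2) by simp
  \<comment> \<open>Each \<open>e i\<close> is split into its residual and its projection; a
    residual contributes at most \<open>\<eta> / \<delta>\<close>.\<close>
  also have "\<dots> = Re (\<Sum>i\<in>A. l2ip (\<lambda>t. e i t - T (e i) t) (h i)) + Re (\<Sum>i\<in>A. l2ip (T (e i)) (h i))"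
    using A hL2 TL2 by (simp add: sum_subtractf)
  also have "Re (\<Sum>i\<in>A. l2ip (\<lambda>t. e i t - T (e i) t) (h i)) \<le> (\<Sum>i\<in>A. \<eta> * (1 / \<delta>))"
    unfolding Re_sum
  proof (rule sum_mono)
    fix i assume i: "i \<in> A"
    have "Re (l2ip (\<lambda>t. e i t - T (e i) t) (h i)) \<le> l2norm (\<lambda>t. e i t - T (e i) t) * l2norm (h i)"
      using l2ip_Cauchy_Schwarz[of "\<lambda>t. e i t - T (e i) t" "h i"] A hL2 TL2 i
        complex_Re_le_cmod[of "l2ip (\<lambda>t. e i t - T (e i) t) (h i)"]
      by fastforce
    also have "\<dots> \<le> \<eta> * (1 / \<delta>)"
      using Tle[OF i] h(4)[OF i] order.trans[OF l2norm_nonneg Tle[OF i]]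
      by (intro mult_mono) auto
    finally show "Re (l2ip (\<lambda>t. e i t - T (e i) t) (h i)) \<le> \<eta> * (1 / \<delta>)" .
  qed
  also have "Re (\<Sum>i\<in>A. l2ip (T (e i)) (h i)) = (\<Sum>j\<in>B. Re (\<Sum>i\<in>A. l2ip (e i) (w j) * l2ip (w j) (h i)))"
  proof -
    have "(\<Sum>i\<in>A. l2ip (T (e i)) (h i)) = (\<Sum>i\<in>A. \<Sum>j\<in>B. l2ip (e i) (w j) * l2ip (w j) (h i))"
      unfolding T_def using wL2 hL2 by (intro sum.cong) auto
    also have "\<dots> = (\<Sum>j\<in>B. \<Sum>i\<in>A. l2ip (e i) (w j) * l2ip (w j) (h i))"
      by (rule sum.swap)
    finally show ?thesis
      by (simp only: Re_sum)
  qed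
  also have "\<dots> \<le> real (card B)"
    using sum_mono[of B "\<lambda>j. Re (\<Sum>i\<in>A. l2ip (e i) (w j) * l2ip (w j) (h i))" "\<lambda>_. 1"] tr by simp
  finally show ?thesis
    by (simp add: algebra_simps)
qed

subsection \<open>Time-frequency shifts\<close>

lemma L2_tfshift [intro, simp]:
  assumes "g \<in> L2"
  shows "tfshift g a b \<in> L2"
proof -
  have g: "g \<in> borel_measurable borel"
    using assms by (rule L2D)
  have "integrable lborel (\<lambda>t. (cmod (g ((- a) + 1 * t)))\<^sup>2)"
    by (rule lborel_integrable_real_affine[OF L2D(2)[OF assms]]) simp
  then have "integrable lborel (\<lambda>t. (cmod (tfshift g a b t))\<^sup>2)"
    by (simp add: tfshift_def norm_mult)
  moreover have "(\<lambda>t. g (t - a)) \<in> borel_measurable borel"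
    by (rule measurable_compose[OF _ g]) simp
  moreover have "(\<lambda>t. cis (2 * pi * b * t)) \<in> borel_measurable borel"
    unfolding cis_conv_exp by (intro borel_measurable_continuous_onI continuous_intros)
  ultimately show ?thesis
    unfolding L2_def tfshift_def by auto
qed

lemma l2norm_tfshift [simp]: "l2norm (tfshift g a b) = l2norm g"
proof -
  have "(LINT t|lborel. (cmod (g t))\<^sup>2) = (LINT t|lborel. (cmod (g ((- a) + 1 * t)))\<^sup>2)"
    using lborel_integral_real_affine[of 1 "\<lambda>t. (cmod (g t))\<^sup>2" "- a"] by simp
  then show ?thesis
    by (simp add: l2norm_def tfshift_def norm_mult)
qed

abbreviation tf :: "(real \<Rightarrow> complex) \<Rightarrow> real \<times> real \<Rightarrow> real \<Rightarrow> complex" where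
  "tf g p \<equiv> tfshift g (fst p) (snd p)"

lemma tfshift_add: "tfshift (\<lambda>t. f t + g t) a b = (\<lambda>t. tfshift f a b t + tfshift g a b t)"
  by (simp add: tfshift_def algebra_simps)

lemma tfshift_diff: "tfshift (\<lambda>t. f t - g t) a b = (\<lambda>t. tfshift f a b t - tfshift g a b t)"
  by (simp add: tfshift_def algebra_simps)

lemma tfshift_cmult: "tfshift (\<lambda>t. c * g t) a b = (\<lambda>t. c * tfshift g a b t)"
  by (simp add: tfshift_def algebra_simps)

text \<open>Shifts form a projective representation of the plane: moving the modulation of
  \<open>p\<close> past the translation of \<open>q\<close> leaves a unimodular factor independent
  of \<open>t\<close>.\<close>

lemma tf_tf: "tf (tf g p) q = (\<lambda>t. cis (- (2 * pi * snd p * fst q)) * tf g (p + q) t)"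
proof
  fix t
  have "cis (2 * pi * snd q * t) * cis (2 * pi * snd p * (t - fst q))
      = cis (- (2 * pi * snd p * fst q)) * cis (2 * pi * snd (p + q) * t)"
    by (simp add: cis_mult algebra_simps)
  then show "tf (tf g p) q t = cis (- (2 * pi * snd p * fst q)) * tf g (p + q) t"
    by (simp add: tfshift_def mult.assoc[symmetric] diff_diff_eq add.commute)
qed

lemma union_index_iff: "i \<in> union_index N x \<Lambda> \<longleftrightarrow> (\<exists>n\<in>{1..N}. \<exists>q\<in>\<Lambda>. i = (n, x n + q))"
  by (cases i) (auto simp: union_index_def)

lemma union_family_L2:
  assumes "\<And>n. n \<in> {1..N} \<Longrightarrow> g n \<in> L2" "i \<in> union_index N x \<Lambda>"
  shows "union_family g i \<in> L2"
  using assms by (auto simp: union_index_def union_family_def)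

text \<open>The phases of \<open>tf_tf\<close> are absorbed in the coefficients, so only the indices
  move.\<close>

lemma fam_span_union_family_tf:
  assumes "h \<in> fam_span (union_family g) J"
  shows "tf h q \<in> fam_span (union_family g) ((\<lambda>(n, p). (n, p + q)) ` J)"
  using assms
proof (induction rule: fam_span_induct)
  case zero
  then show ?case
    using fam_span_zero by (simp add: tfshift_def)
next
  case (add h k)
  then show ?case
    unfolding tfshift_add by (rule fam_span_add)
next
  case (base c j)
  obtain n p where j: "j = (n, p)"
    by (cases j)
  have "union_family g (n, p + q) \<in> fam_span (union_family g) ((\<lambda>(n, p). (n, p + q)) ` J)"
    using base j by (intro fam_span_base) force
  then have "(\<lambda>t. c * (cis (- (2 * pi * snd p * fst q)) * union_family g (n, p + q) t))
      \<in> fam_span (union_family g) ((\<lambda>(n, p). (n, p + q)) ` J)"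
    by (intro fam_span_cmult)
  moreover have "tf (\<lambda>t. c * union_family g j t) q
      = (\<lambda>t. c * (cis (- (2 * pi * snd p * fst q)) * union_family g (n, p + q) t))"
    unfolding tfshift_cmult by (simp add: union_family_def j tf_tf)
  ultimately show ?case
    by simp
qed

text \<open>The shift by \<open>-q\<close> is a unitary operator that permutes the system up to unimodular factors.\<close>
lemma dist_to_others_shift:
  assumes "\<And>m r. (m, r) \<in> I \<Longrightarrow> (m, r - q) \<in> I"
  shows "dist_to_others (union_family g) I (n, p) \<le> dist_to_others (union_family g) I (n, p + q)"
proof (rule dist_to_others_ge)
  fix h assume h: "h \<in> fam_span (union_family g) (I - {(n, p + q)})"
  \<comment> \<open>The phase by which the element at \<open>p + q\<close>, shifted back by
    \<open>q\<close>, differs from the element at \<open>p\<close>.\<close>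
  define c where "c = cis (- (2 * pi * snd (p + q) * fst (- q)))"
  have c: "cmod c = 1" "c \<noteq> 0"
    by (simp_all add: c_def)
  have "(\<lambda>(n, p). (n, p + (- q))) ` (I - {(n, p + q)}) \<subseteq> I - {(n, p)}"
    using assms by auto
  then have "tf h (- q) \<in> fam_span (union_family g) (I - {(n, p)})"
    using fam_span_union_family_tf[OF h, of "- q"] fam_span_mono by blast
  then have "(\<lambda>t. inverse c * tf h (- q) t) \<in> fam_span (union_family g) (I - {(n, p)})"
    by (rule fam_span_cmult)
  then have "dist_to_others (union_family g) I (n, p)
      \<le> l2norm (\<lambda>t. union_family g (n, p) t - inverse c * tf h (- q) t)"
    by (rule dist_to_others_le)
  also have "\<dots> = l2norm (\<lambda>t. c * (union_family g (n, p) t - inverse c * tf h (- q) t))"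
    using c by simp
  also have "(\<lambda>t. c * (union_family g (n, p) t - inverse c * tf h (- q) t))
      = (\<lambda>t. c * union_family g (n, p) t - tf h (- q) t)"
    using c(2) by (simp add: right_diff_distrib mult.assoc[symmetric])
  also have "\<dots> = tf (\<lambda>t. union_family g (n, p + q) t - h t) (- q)"
    using tf_tf[of "g n" "p + q" "- q"] unfolding tfshift_diff
    by (simp add: union_family_def c_def)
  also have "l2norm \<dots> = l2norm (\<lambda>t. union_family g (n, p + q) t - h t)"
    by simp
  finally show "dist_to_others (union_family g) I (n, p) \<le> l2norm (\<lambda>t. union_family g (n, p + q) t - h t)" .
qed

lemma lattice_diff:
  assumes "p \<in> lattice v w" "q \<in> lattice v w"
  shows "p - q \<in> lattice v w"
proof -
  obtain a b c d where p: "p = of_int a *\<^sub>R v + of_int b *\<^sub>R w" and q: "q = of_int c *\<^sub>R v + of_int d *\<^sub>R w"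
    using assms by (auto simp: lattice_def)
  have "p - q = of_int (a - c) *\<^sub>R v + of_int (b - d) *\<^sub>R w"
    by (simp add: p q algebra_simps)
  then show ?thesis
    unfolding lattice_def by blast
qed

lemma zero_in_lattice: "0 \<in> lattice v w"
  unfolding lattice_def by (force intro: exI[of _ "0::int"])

text \<open>Lattice shifts act on the index set with the \<open>N\<close> orbits of the points
  \<open>(n, x n)\<close>, and the distance to the others is nowhere on an orbit smaller than at its
  base point. A minimum over finitely many base points is positive.\<close>

lemma minimal_imp_uniformly_minimal:
  assumes "minimal_sys (union_family g) (union_index N x (lattice v w))"
  shows "uniformly_minimal_sys (union_family g) (union_index N x (lattice v w))"
proof -
  define I where "I = union_index N x (lattice v w)"
  have base: "(n, x n) \<in> I" if "n \<in> {1..N}" for n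
    using that zero_in_lattice[of v w] by (auto simp: I_def union_index_def intro!: image_eqI[of _ _ 0])
  have pos: "dist_to_others (union_family g) I (n, x n) > 0" if "n \<in> {1..N}" for n
    using assms base[OF that] by (auto simp: minimal_sys_def I_def)
  \<comment> \<open>The extra 1 keeps the set nonempty when \<open>N = 0\<close>.\<close>
  define \<delta> where "\<delta> = Min (insert 1 ((\<lambda>n. dist_to_others (union_family g) I (n, x n)) ` {1..N}))"
  have "\<delta> > 0"
    unfolding \<delta>_def using pos by (subst Min_gr_iff) auto
  moreover have "\<delta> \<le> dist_to_others (union_family g) I i" if "i \<in> I" for i
  proof -
    obtain n q where n: "n \<in> {1..N}" "q \<in> lattice v w" and i: "i = (n, x n + q)"
      using \<open>i \<in> I\<close> unfolding I_def union_index_iff by blast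
    have "\<delta> \<le> dist_to_others (union_family g) I (n, x n)"
      unfolding \<delta>_def using n by (intro Min_le) auto
    also have "\<dots> \<le> dist_to_others (union_family g) I (n, x n + q)"
    proof (rule dist_to_others_shift)
      fix m r assume "(m, r) \<in> I"
      then show "(m, r - q) \<in> I"
        using lattice_diff[OF _ n(2)] unfolding I_def union_index_iff by (force simp: algebra_simps)
    qed
    finally show ?thesis
      by (simp add: i)
  qed
  ultimately show ?thesis
    unfolding uniformly_minimal_sys_def I_def by blast
qed

section \<open>Continuous approximation and strong continuity of time-frequency shifts\<close>

lemma l2norm_tendsto_zero:
  assumes "\<And>k. s k \<in> borel_measurable borel" "integrable lborel u"
    and "AE t in lborel. (\<lambda>k. s k t) \<longlonglongrightarrow> 0" "\<And>k t. (cmod (s k t))\<^sup>2 \<le> u t"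
  shows "(\<lambda>k. l2norm (s k)) \<longlonglongrightarrow> 0"
proof -
  have "(\<lambda>k. LINT t|lborel. (cmod (s k t))\<^sup>2) \<longlonglongrightarrow> (LINT t|(lborel :: real measure). (0::real))"
  proof (rule integral_dominated_convergence[where w = u])
    show "AE t in lborel. (\<lambda>k. (cmod (s k t))\<^sup>2) \<longlonglongrightarrow> 0"
      using assms(3)
    proof eventually_elim
      case (elim t)
      then show ?case
        using tendsto_power[OF tendsto_norm[OF elim], of 2] by simp
    qed
    show "AE t in lborel. norm ((cmod (s k t))\<^sup>2) \<le> u t" for k
      using assms(4) by simp
    show "(\<lambda>t. (cmod (s k t))\<^sup>2) \<in> borel_measurable lborel" for k
      using assms(1)[of k] by simp
  qed (use assms(2) in auto)
  then have "(\<lambda>k. sqrt (LINT t|lborel. (cmod (s k t))\<^sup>2)) \<longlonglongrightarrow> sqrt 0"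
    by (intro tendsto_real_sqrt) simp
  then show ?thesis
    by (simp add: l2norm_def)
qed

lemma continuous_compact_support_bounded:
  fixes h :: "real \<Rightarrow> complex"
  assumes "continuous_on UNIV h" "\<And>t. M \<le> \<bar>t\<bar> \<Longrightarrow> h t = 0"
  obtains B where "B > 0" "\<And>t. cmod (h t) \<le> B"
proof -
  have "compact (h ` {-M..M})"
    using assms(1) by (intro compact_continuous_image continuous_on_subset[OF assms(1)]) auto
  then have "bounded (h ` {-M..M})"
    by (rule compact_imp_bounded)
  then obtain B where B: "B > 0" "\<forall>y\<in>h ` {-M..M}. cmod y \<le> B"
    by (auto simp: bounded_pos)
  have "cmod (h t) \<le> B" for t
  proof (cases "M \<le> \<bar>t\<bar>")
    case False
    then have "t \<in> {-M..M}"
      by auto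
    then show ?thesis
      using B by blast
  qed (use B(1) assms(2)[of t] in simp)
  then show ?thesis
    using that B by blast
qed

lemma continuous_compact_support_L2:
  assumes "continuous_on UNIV h" "\<And>t. M \<le> \<bar>t\<bar> \<Longrightarrow> h t = 0"
  shows "h \<in> L2"
proof -
  obtain B where B: "B > 0" "\<And>t. cmod (h t) \<le> B"
    using continuous_compact_support_bounded[OF assms] by blast
  show ?thesis
  proof (rule L2I_bound)
    show "h \<in> borel_measurable borel"
      using assms(1) by (rule borel_measurable_continuous_onI)
    show "integrable lborel (\<lambda>t. B\<^sup>2 * indicator {-M..M} t)"
      by (intro integrable_mult_right integrable_real_indicator) (auto simp: emeasure_lborel_Icc_eq)
    show "(cmod (h t))\<^sup>2 \<le> B\<^sup>2 * indicator {-M..M} t" for t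
      using B assms(2)[of t] by (auto simp: indicator_def abs_le_iff intro!: power_mono)
  qed
qed

text \<open>Vanishing at the integers costs nothing in \<^term>\<open>L2\<close>; it makes the pieces of \<open>h\<close> on the intervals
  between consecutive integers continuous functions on the circle.\<close>
lemma L2_approx_continuous:
  assumes "f \<in> L2" "\<epsilon> > 0"
  obtains h and M :: nat where "continuous_on UNIV h" "\<And>t. real M \<le> \<bar>t\<bar> \<Longrightarrow> h t = 0"
    "\<And>k :: int. h (of_int k) = 0" "l2norm (\<lambda>t. f t - h t) < \<epsilon>"
proof -
  have fm [measurable]: "f \<in> borel_measurable borel"
    using assms(1) by (rule L2D)
  \<comment> \<open>Truncation both in height and in support, so that a constant on a bounded
    interval can serve as majorant later.\<close>
  define F where "F = (\<lambda>(K::nat) t. if cmod (f t) \<le> real K \<and> \<bar>t\<bar> \<le> real K then f t else 0)"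
  have Fm [measurable]: "F K \<in> borel_measurable borel" for K
    unfolding F_def by measurable
  have "(\<lambda>K. l2norm (\<lambda>t. f t - F K t)) \<longlonglongrightarrow> 0"
  proof (rule l2norm_tendsto_zero[OF _ L2D(2)[OF assms(1)]])
    show "AE t in lborel. (\<lambda>K. f t - F K t) \<longlonglongrightarrow> 0"
    proof (rule AE_I2, rule tendsto_eventually)
      fix t
      show "eventually (\<lambda>K. f t - F K t = 0) sequentially"
        using eventually_ge_at_top[of "nat \<lceil>max (cmod (f t)) \<bar>t\<bar>\<rceil>"]
        by eventually_elim (simp add: F_def nat_le_iff ceiling_le_iff)
    qed
  qed (auto simp: F_def)
  then have "eventually (\<lambda>K. l2norm (\<lambda>t. f t - F K t) < \<epsilon> / 2) sequentially"
    using assms(2) by (intro order_tendstoD) auto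
  then have ev: "eventually (\<lambda>K. l2norm (\<lambda>t. f t - F K t) < \<epsilon> / 2 \<and> K \<ge> 1) sequentially"
    using eventually_ge_at_top[of "1::nat"] by eventually_elim auto
  obtain K :: nat where K: "l2norm (\<lambda>t. f t - F K t) < \<epsilon> / 2" "K \<ge> 1"
    using eventually_happens'[OF sequentially_bot ev] by blast
  have Fb: "cmod (F K t) \<le> K" and F0: "real K < \<bar>t\<bar> \<Longrightarrow> F K t = 0" for t
    by (auto simp: F_def)
  have "F K \<in> borel_measurable lebesgue"
    by (intro measurable_completion) simp
  then have "F K measurable_on UNIV"
    by (rule lebesgue_measurable_imp_measurable_on) simp
  then obtain Z G where Z: "negligible Z" and G: "\<And>n. continuous_on UNIV (G n)"
      "\<And>t. t \<notin> Z \<Longrightarrow> (\<lambda>n. G n t) \<longlonglongrightarrow> F K t"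
    by (auto simp: measurable_on_def)
  \<comment> \<open>A continuous cutoff, zero at the integers and outside \<open>(-K, K)\<close> and
    positive elsewhere; hence \<open>min 1 (real n * \<sigma> t)\<close> tends to 1 almost
    everywhere on that interval.\<close>
  define \<sigma> where "\<sigma> = (\<lambda>t. \<bar>sin (pi * t)\<bar> * max 0 (real K - \<bar>t\<bar>))"
  \<comment> \<open>The factor \<open>K / max K (cmod (G n t))\<close> clips the modulus at
    \<open>K\<close> continuously and does not change the limit, whose modulus is at most
    \<open>K\<close>.\<close>
  define H where "H = (\<lambda>(n::nat) t. of_real (real K * min 1 (real n * \<sigma> t) / max (real K) (cmod (G n t))) * G n t)"
  have Hc: "continuous_on UNIV (H n)" for n
    unfolding H_def \<sigma>_def using K(2) by (intro continuous_intros G) auto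
  have \<sigma>: "0 \<le> \<sigma> t" for t
    by (simp add: \<sigma>_def)
  have Hb: "cmod (H n t) \<le> K" for n t
  proof -
    have "cmod (H n t) = min 1 (real n * \<sigma> t) * (real K * (cmod (G n t) / max (real K) (cmod (G n t))))"
      using \<sigma>[of t] by (simp add: H_def norm_mult norm_divide abs_mult)
    also have "\<dots> \<le> 1 * (real K * 1)"
      using K(2) \<sigma>[of t] by (intro mult_mono) (auto simp: divide_le_eq_1 max_def)
    finally show ?thesis by simp
  qed
  have H0: "H n t = 0" if "real K \<le> \<bar>t\<bar>" for n t
    using that by (simp add: H_def \<sigma>_def)
  have "AE t in lborel. t \<notin> Z"
    using Z AE_not_in[of Z lebesgue] by (simp add: negligible_iff_null_sets AE_completion_iff)
  moreover have "AE t in lborel. t \<notin> (\<int>::real set)"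
    by (intro AE_not_in countable_imp_null_set_lborel) (auto simp: Ints_def)
  ultimately have lim: "AE t in lborel. (\<lambda>n. F K t - H n t) \<longlonglongrightarrow> 0"
  proof eventually_elim
    case (elim t)
    have "t \<noteq> real K" "t \<noteq> - real K"
      using elim(2) by auto
    then consider "real K < \<bar>t\<bar>" | "\<bar>t\<bar> < real K"
      by linarith
    then have "(\<lambda>n. H n t) \<longlonglongrightarrow> F K t"
    proof cases
      case 1
      then show ?thesis
        using F0 H0 by simp
    next
      case 2
      have "sin (pi * t) \<noteq> 0"
      proof
        assume "sin (pi * t) = 0"
        then obtain i where "pi * t = of_int i * pi"
          by (auto simp: sin_zero_iff_int2)
        then show False
          using elim(2) by (simp add: mult.commute)
      qed
      then have pos: "\<sigma> t > 0"
        using 2 by (simp add: \<sigma>_def)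
      have "eventually (\<lambda>n. real n \<ge> 1 / \<sigma> t) sequentially"
        using filterlim_real_sequentially by (auto simp: filterlim_at_top)
      then have "eventually (\<lambda>n. min 1 (real n * \<sigma> t) = 1) sequentially"
        by eventually_elim (use pos in \<open>simp add: field_simps\<close>)
      then have "(\<lambda>n. min 1 (real n * \<sigma> t)) \<longlonglongrightarrow> 1"
        by (rule tendsto_eventually)
      then have "(\<lambda>n. H n t) \<longlonglongrightarrow> of_real (real K * 1 / max (real K) (cmod (F K t))) * F K t"
        unfolding H_def using K(2) G(2)[OF elim(1)] by (intro tendsto_intros) auto
      moreover have "max (real K) (cmod (F K t)) = real K"
        using Fb[of t] by simp
      ultimately show ?thesis
        using K(2) by simp
    qed
    then show ?case
      using tendsto_diff[OF tendsto_const[of "F K t"]] by force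
  qed
  have HM: "H n \<in> borel_measurable borel" for n
    by (rule borel_measurable_continuous_onI[OF Hc])
  have "(\<lambda>n. l2norm (\<lambda>t. F K t - H n t)) \<longlonglongrightarrow> 0"
  proof (rule l2norm_tendsto_zero[OF _ _ lim])
    show "integrable lborel (\<lambda>t. (2 * real K)\<^sup>2 * indicator {-real K..real K} t)"
      by (intro integrable_mult_right integrable_real_indicator) (auto simp: emeasure_lborel_Icc_eq)
    show "(cmod (F K t - H n t))\<^sup>2 \<le> (2 * real K)\<^sup>2 * indicator {-real K..real K} t" for n t
    proof (cases "\<bar>t\<bar> \<le> real K")
      case True
      have "cmod (F K t - H n t) \<le> 2 * real K"
        using norm_triangle_ineq4[of "F K t" "H n t"] Fb[of t] Hb[of n t] by linarith
      then have "(cmod (F K t - H n t))\<^sup>2 \<le> (2 * real K)\<^sup>2"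
        by (intro power_mono) auto
      then show ?thesis
        using True by (simp add: indicator_def abs_le_iff)
    next
      case False
      then show ?thesis
        using F0[of t] H0[of t n] by simp
    qed
    show "(\<lambda>t. F K t - H n t) \<in> borel_measurable borel" for n
      using HM by (intro borel_measurable_diff) simp_all
  qed
  then have ev': "eventually (\<lambda>n. l2norm (\<lambda>t. F K t - H n t) < \<epsilon> / 2) sequentially"
    using assms(2) by (intro order_tendstoD) auto
  obtain n where n: "l2norm (\<lambda>t. F K t - H n t) < \<epsilon> / 2"
    using eventually_happens'[OF sequentially_bot ev'] by blast
  have HL2: "H n \<in> L2"
    by (rule continuous_compact_support_L2[OF Hc H0])
  have FL2: "F K \<in> L2"
    by (rule L2I_bound[OF Fm L2D(2)[OF assms(1)]]) (auto simp: F_def)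
  show thesis
  proof
    show "continuous_on UNIV (H n)"
      by (rule Hc)
    show "H n t = 0" if "real K \<le> \<bar>t\<bar>" for t
      by (rule H0[OF that])
    show "H n (of_int k) = 0" for k
      by (simp add: H_def \<sigma>_def sin_zero_iff_int2 mult.commute)
    show "l2norm (\<lambda>t. f t - H n t) < \<epsilon>"
      using l2norm_triangle_diff[OF assms(1) FL2 HL2] K(1) n by linarith
  qed
qed

text \<open>The translations along a convergent sequence are bounded, so all shifted functions live
  on one bounded interval and dominated convergence applies; pointwise convergence is the continuity
  of \<open>h\<close>.\<close>

lemma tf_continuous_compact_support:
  fixes z :: "nat \<Rightarrow> real \<times> real"
  assumes h: "continuous_on UNIV h" "\<And>t. M \<le> \<bar>t\<bar> \<Longrightarrow> h t = 0" and z: "z \<longlonglongrightarrow> z0"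
  shows "(\<lambda>k. l2norm (\<lambda>t. tf h (z k) t - tf h z0 t)) \<longlonglongrightarrow> 0"
proof -
  obtain B where B: "B > 0" "\<And>t. cmod (h t) \<le> B"
    using continuous_compact_support_bounded[OF h] by blast
  have hL2: "h \<in> L2"
    by (rule continuous_compact_support_L2[OF h])
  have fz: "(\<lambda>k. fst (z k)) \<longlonglongrightarrow> fst z0" and sz: "(\<lambda>k. snd (z k)) \<longlonglongrightarrow> snd z0"
    using tendsto_fst[OF z] tendsto_snd[OF z] .
  obtain C where C: "\<And>k. \<bar>fst (z k)\<bar> \<le> C"
    using fz Bseq_def convergent_imp_Bseq convergent_def by (metis real_norm_def)
  have C0: "\<bar>fst z0\<bar> \<le> C"
    by (rule LIMSEQ_le_const2[OF tendsto_rabs[OF fz]]) (use C in auto)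
  have tfb: "cmod (tf h p t) \<le> B * indicator {-(M + C)..M + C} t" if "\<bar>fst p\<bar> \<le> C" for p t
  proof (cases "M \<le> \<bar>t - fst p\<bar>")
    case True
    then show ?thesis
      using h(2) B(1) by (simp add: tfshift_def)
  next
    case False
    then have "\<bar>t\<bar> \<le> M + C"
      using that by linarith
    then show ?thesis
      using B by (simp add: tfshift_def norm_mult indicator_def abs_le_iff)
  qed
  show ?thesis
  proof (rule l2norm_tendsto_zero)
    show "(\<lambda>t. tf h (z k) t - tf h z0 t) \<in> borel_measurable borel" for k
      using hL2 by (intro L2D(1)) auto
    show "integrable lborel (\<lambda>t. (2 * B)\<^sup>2 * indicator {-(M + C)..M + C} t)"
      by (intro integrable_mult_right integrable_real_indicator) (auto simp: emeasure_lborel_Icc_eq)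
    show "(cmod (tf h (z k) t - tf h z0 t))\<^sup>2 \<le> (2 * B)\<^sup>2 * indicator {-(M + C)..M + C} t" for k t
    proof -
      have "cmod (tf h (z k) t - tf h z0 t) \<le> 2 * B * indicator {-(M + C)..M + C} t"
        using norm_triangle_ineq4[of "tf h (z k) t" "tf h z0 t"] tfb[OF C[of k], of t] tfb[OF C0, of t]
        by linarith
      then have "(cmod (tf h (z k) t - tf h z0 t))\<^sup>2 \<le> (2 * B * indicator {-(M + C)..M + C} t)\<^sup>2"
        by (intro power_mono) auto
      then show ?thesis
        by (cases "t \<in> {-(M + C)..M + C}") (simp_all add: power_mult_distrib)
    qed
    show "AE t in lborel. (\<lambda>k. tf h (z k) t - tf h z0 t) \<longlonglongrightarrow> 0"
    proof (rule AE_I2)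
      fix t
      have "(\<lambda>k. h (t - fst (z k))) \<longlonglongrightarrow> h (t - fst z0)"
        using h(1) fz by (intro continuous_on_tendsto_compose[of UNIV h]) (auto intro!: tendsto_intros)
      moreover have "(\<lambda>k. cis (2 * pi * snd (z k) * t)) \<longlonglongrightarrow> cis (2 * pi * snd z0 * t)"
        unfolding cis_conv_exp by (intro tendsto_intros z)
      ultimately have "(\<lambda>k. tf h (z k) t) \<longlonglongrightarrow> tf h z0 t"
        unfolding tfshift_def by (rule tendsto_mult[rotated])
      then show "(\<lambda>k. tf h (z k) t - tf h z0 t) \<longlonglongrightarrow> 0"
        using LIM_zero by blast
    qed
  qed
qed

text \<open>Shifts are isometric, so replacing \<open>g\<close> by a continuous compactly supported
  \<open>h\<close> costs the same small error for every \<open>k\<close>.\<close>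

lemma tf_continuous:
  fixes z :: "nat \<Rightarrow> real \<times> real"
  assumes g: "g \<in> L2" and z: "z \<longlonglongrightarrow> z0"
  shows "(\<lambda>k. l2norm (\<lambda>t. tf g (z k) t - tf g z0 t)) \<longlonglongrightarrow> 0"
proof (rule LIMSEQ_I)
  fix \<epsilon> :: real assume "\<epsilon> > 0"
  obtain h and M :: nat where h: "continuous_on UNIV h" "\<And>t. real M \<le> \<bar>t\<bar> \<Longrightarrow> h t = 0"
    "\<And>k :: int. h (of_int k) = 0" "l2norm (\<lambda>t. g t - h t) < \<epsilon> / 3"
    using L2_approx_continuous[OF g, of "\<epsilon> / 3"] \<open>\<epsilon> > 0\<close> by auto
  have hL2: "h \<in> L2"
    using continuous_compact_support_L2[OF h(1,2)] .
  have "(\<lambda>k. l2norm (\<lambda>t. tf h (z k) t - tf h z0 t)) \<longlonglongrightarrow> 0"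
    by (rule tf_continuous_compact_support[OF h(1,2) z])
  then have "eventually (\<lambda>k. l2norm (\<lambda>t. tf h (z k) t - tf h z0 t) < \<epsilon> / 3) sequentially"
    using \<open>\<epsilon> > 0\<close> by (intro order_tendstoD) auto
  then obtain k0 where k0: "\<And>k. k \<ge> k0 \<Longrightarrow> l2norm (\<lambda>t. tf h (z k) t - tf h z0 t) < \<epsilon> / 3"
    by (auto simp: eventually_sequentially)
  have near: "l2norm (\<lambda>t. tf g p t - tf h p t) < \<epsilon> / 3" for p
    using h(4) l2norm_tfshift[of "\<lambda>t. g t - h t" "fst p" "snd p"] by (simp add: tfshift_diff)
  have "norm (l2norm (\<lambda>t. tf g (z k) t - tf g z0 t) - 0) < \<epsilon>" if "k \<ge> k0" for k
  proof -
    have "l2norm (\<lambda>t. tf g (z k) t - tf g z0 t)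
        \<le> l2norm (\<lambda>t. tf g (z k) t - tf h (z k) t) + l2norm (\<lambda>t. tf h (z k) t - tf g z0 t)"
      using g hL2 by (intro l2norm_triangle_diff) auto
    also have "l2norm (\<lambda>t. tf h (z k) t - tf g z0 t)
        \<le> l2norm (\<lambda>t. tf h (z k) t - tf h z0 t) + l2norm (\<lambda>t. tf h z0 t - tf g z0 t)"
      using g hL2 by (intro l2norm_triangle_diff) auto
    finally show ?thesis
      using near[of "z k"] near[of z0] k0[OF that] l2norm_minus_commute[of "tf h z0" "tf g z0"]
      by simp
  qed
  then show "\<exists>k0. \<forall>k\<ge>k0. norm (l2norm (\<lambda>t. tf g (z k) t - tf g z0 t) - 0) < \<epsilon>"
    by blast
qed

text \<open>Total boundedness of the orbit of \<open>g\<close> over \<open>K\<close>: finitely many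
  balls, with radii from the continuity of the orbit map, cover \<open>K\<close>.\<close>

lemma tf_compact_net:
  fixes K :: "(real \<times> real) set"
  assumes K: "compact K" and g: "g \<in> L2" and "\<epsilon> > 0"
  obtains Z where "finite Z" "Z \<subseteq> K" "\<And>z. z \<in> K \<Longrightarrow> \<exists>z0\<in>Z. l2norm (\<lambda>t. tf g z t - tf g z0 t) < \<epsilon>"
proof -
  have "\<exists>d>0. \<forall>z. dist z z0 < d \<longrightarrow> l2norm (\<lambda>t. tf g z t - tf g z0 t) < \<epsilon>" for z0
  proof -
    have "continuous (at z0) (\<lambda>z. l2norm (\<lambda>t. tf g z t - tf g z0 t))"
      unfolding continuous_at_sequentially o_def
      using tf_continuous[OF g] by (simp add: l2norm_def)
    then obtain d where "d > 0" "\<And>z. dist z z0 < d \<Longrightarrow>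
        dist (l2norm (\<lambda>t. tf g z t - tf g z0 t)) (l2norm (\<lambda>t. tf g z0 t - tf g z0 t)) < \<epsilon>"
      using \<open>\<epsilon> > 0\<close> unfolding continuous_at_eps_delta by blast
    moreover have "l2norm (\<lambda>t. tf g z0 t - tf g z0 t) = 0"
      by (simp add: l2norm_def)
    ultimately show ?thesis
      by (auto simp: dist_real_def)
  qed
  then obtain d where d: "\<And>z0. d z0 > 0"
      "\<And>z0 z. dist z z0 < d z0 \<Longrightarrow> l2norm (\<lambda>t. tf g z t - tf g z0 t) < \<epsilon>"
    by metis
  obtain Z where Z: "Z \<subseteq> K" "finite Z" "K \<subseteq> (\<Union>z0\<in>Z. ball z0 (d z0))"
    by (rule compactE_image[OF K, of K "\<lambda>z0. ball z0 (d z0)"]) (use d(1) in auto)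
  show thesis
  proof
    show "\<exists>z0\<in>Z. l2norm (\<lambda>t. tf g z t - tf g z0 t) < \<epsilon>" if "z \<in> K" for z
    proof -
      obtain z0 where "z0 \<in> Z" "z \<in> ball z0 (d z0)"
        using Z(3) \<open>z \<in> K\<close> by blast
      then show ?thesis
        using d(2)[of z z0] by (auto simp: dist_commute)
    qed
  qed (use Z in auto)
qed

subsection \<open>Comparison of two lattice systems\<close>

lemma measure_lebesgue_unit_square:
  fixes a :: "real ^ 2"
  shows "measure lebesgue (box a (\<chi> i. a $ i + 1)) = 1"
proof -
  have "measure lebesgue (box a (\<chi> i. a $ i + 1)) = measure lborel (cbox a (\<chi> i. a $ i + 1))"
    by (simp add: measure_lborel_box_eq measure_lborel_cbox_eq)
  also have "cbox a (\<chi> i. a $ i + 1) \<noteq> {}"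
    by (simp add: interval_ne_empty_cart)
  then have "measure lborel (cbox a (\<chi> i. a $ i + 1)) = 1"
    by (subst content_cbox_cart) auto
  finally show ?thesis .
qed

text \<open>Open unit squares with distinct integer corners are disjoint and have area one, so the
  area of \<open>T\<close> bounds every finite part of \<open>S\<close>; a common bound on finite
  parts makes \<open>S\<close> finite. The plane is \<open>real ^ 2\<close> because the change of
  area under a linear map is expressed there by the determinant of its matrix.\<close>

lemma card_integer_points_le:
  fixes T :: "(real ^ 2) set" and S :: "(int \<times> int) set"
  assumes T: "T \<in> lmeasurable"
    and sub: "\<And>i k u. (i, k) \<in> S \<Longrightarrow> of_int i \<le> u $ 1 \<Longrightarrow> u $ 1 \<le> of_int i + 1 \<Longrightarrow>
       of_int k \<le> u $ 2 \<Longrightarrow> u $ 2 \<le> of_int k + 1 \<Longrightarrow> u \<in> T"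
  shows "finite S \<and> real (card S) \<le> measure lebesgue T"
proof -
  define Q where "Q = (\<lambda>(i, k). box (vector [of_int i, of_int k] :: real ^ 2)
     (\<chi> j. (vector [of_int i, of_int k] :: real ^ 2) $ j + 1))"
  have memQ: "u \<in> Q (i, k) \<longleftrightarrow> of_int i < u $ 1 \<and> u $ 1 < of_int i + 1 \<and> of_int k < u $ 2 \<and> u $ 2 < of_int k + 1"
    for u i k
    by (auto simp: Q_def mem_box_cart forall_2 vector_2)
  have bound: "real (card G) \<le> measure lebesgue T" if G: "G \<subseteq> S" "finite G" for G
  proof -
    have "disjoint_family_on Q G"
    proof (unfold disjoint_family_on_def, intro ballI impI)
      fix p q assume "p \<in> G" "q \<in> G" "p \<noteq> q"
      obtain i k where p: "p = (i, k)" by (cases p)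
      obtain i' k' where q: "q = (i', k')" by (cases q)
      have False if "u \<in> Q p" "u \<in> Q q" for u
      proof -
        have "i = \<lfloor>u $ 1\<rfloor>" "i' = \<lfloor>u $ 1\<rfloor>" "k = \<lfloor>u $ 2\<rfloor>" "k' = \<lfloor>u $ 2\<rfloor>"
          using that by (auto simp: p q memQ intro!: floor_unique[symmetric])
        then show False
          using \<open>p \<noteq> q\<close> p q by simp
      qed
      then show "Q p \<inter> Q q = {}"
        by blast
    qed
    then have "(\<Sum>p\<in>G. measure lebesgue (Q p)) = measure lebesgue (\<Union>p\<in>G. Q p)"
    proof (intro measure_finite_Union[symmetric])
      show "emeasure lebesgue (Q p) \<noteq> \<infinity>" for p
        by (cases p) (simp add: Q_def emeasure_lborel_box_eq)
      show "Q ` G \<subseteq> sets lebesgue"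
        by (auto simp: Q_def)
    qed (use G in auto)
    moreover have "(\<Sum>p\<in>G. measure lebesgue (Q p)) = real (card G)"
      by (simp add: Q_def measure_lebesgue_unit_square split_def)
    moreover have "measure lebesgue (\<Union>p\<in>G. Q p) \<le> measure lebesgue T"
    proof (rule measure_mono_fmeasurable[OF _ _ T])
      show "(\<Union>p\<in>G. Q p) \<subseteq> T"
        using G(1) sub by (fastforce simp: memQ intro: less_imp_le)
      show "(\<Union>p\<in>G. Q p) \<in> sets lebesgue"
        using G(2) by (intro sets.finite_UN) (auto simp: Q_def)
    qed
    ultimately show ?thesis by simp
  qed
  have "card G \<le> nat \<lfloor>measure lebesgue T\<rfloor>" if "G \<subseteq> S" "finite G" for G
    using bound[OF that] by (simp add: le_nat_iff le_floor_iff)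
  then have "finite S"
    using finite_if_finite_subsets_card_bdd by blast
  then show ?thesis
    using bound by blast
qed

lemma det_matrix_2:
  fixes a b c d :: real
  shows "det (matrix (\<lambda>u :: real ^ 2. vector [a * u $ 1 + b * u $ 2, c * u $ 1 + d * u $ 2] :: real ^ 2)) = a * d - b * c"
  by (simp add: det_2 matrix_def axis_def vector_2)

text \<open>The unit squares at the counted points lie in the image of \<open>[-R, m + R]\<^sup>2\<close>
  under the linear map.\<close>
lemma lattice_points_near_parallelogram:
  fixes a b c d C :: real
  assumes D: "a * d - b * c \<noteq> 0" and C: "C \<ge> 0"
  obtains K where "K \<ge> 0" "\<And>m :: nat. finite {(i, k). \<exists>s\<in>{0..real m}. \<exists>t\<in>{0..real m}.
      \<bar>of_int i - (a * s + b * t)\<bar> \<le> C \<and> \<bar>of_int k - (c * s + d * t)\<bar> \<le> C}"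
    "\<And>m :: nat. real (card {(i, k). \<exists>s\<in>{0..real m}. \<exists>t\<in>{0..real m}.
      \<bar>of_int i - (a * s + b * t)\<bar> \<le> C \<and> \<bar>of_int k - (c * s + d * t)\<bar> \<le> C}) \<le> \<bar>a * d - b * c\<bar> * (real m + K)\<^sup>2"
proof -
  define L where "L = (\<lambda>u :: real ^ 2. vector [a * u $ 1 + b * u $ 2, c * u $ 1 + d * u $ 2] :: real ^ 2)"
  define D where "D = a * d - b * c"
  have D0: "D \<noteq> 0"
    using D by (simp add: D_def)
  have lin: "linear L"
    by (auto simp: linear_iff L_def vec_eq_iff forall_2 vector_2 algebra_simps)
  \<comment> \<open>The inverse matrix has, up to sign and order, the given entries divided by
    \<open>D\<close>, so displacements of size \<open>C + 1\<close> have preimages of size at most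
    \<open>R\<close>. The added 1 is the side of the unit square.\<close>
  define R where "R = (\<bar>a\<bar> + \<bar>b\<bar> + \<bar>c\<bar> + \<bar>d\<bar>) * (C + 1) / \<bar>D\<bar>"
  have R: "R \<ge> 0"
    using C by (simp add: R_def)
  have Rb: "\<bar>(x * r - y * q) / D\<bar> \<le> R" if "\<bar>r\<bar> \<le> C + 1" "\<bar>q\<bar> \<le> C + 1"
    "\<bar>x\<bar> + \<bar>y\<bar> \<le> \<bar>a\<bar> + \<bar>b\<bar> + \<bar>c\<bar> + \<bar>d\<bar>" for x y r q
  proof -
    have "\<bar>x * r - y * q\<bar> \<le> \<bar>x\<bar> * \<bar>r\<bar> + \<bar>y\<bar> * \<bar>q\<bar>"
      using abs_triangle_ineq4[of "x * r" "y * q"] by (simp add: abs_mult)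
    also have "\<dots> \<le> \<bar>x\<bar> * (C + 1) + \<bar>y\<bar> * (C + 1)"
      using that by (intro add_mono mult_left_mono) auto
    also have "\<dots> = (\<bar>x\<bar> + \<bar>y\<bar>) * (C + 1)"
      by (simp add: ring_distribs)
    also have "\<dots> \<le> (\<bar>a\<bar> + \<bar>b\<bar> + \<bar>c\<bar> + \<bar>d\<bar>) * (C + 1)"
      using that C by (intro mult_right_mono) auto
    finally show ?thesis
      by (simp add: R_def abs_divide divide_right_mono)
  qed
  define S where "S = (\<lambda>m::nat. {(i::int, k::int). \<exists>s\<in>{0..real m}. \<exists>t\<in>{0..real m}.
      \<bar>of_int i - (a * s + b * t)\<bar> \<le> C \<and> \<bar>of_int k - (c * s + d * t)\<bar> \<le> C})"
  define P where "P = (\<lambda>m::nat. cbox (\<chi> j. - R) (\<chi> j. real m + R) :: (real ^ 2) set)"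
  have main: "finite (S m) \<and> real (card (S m)) \<le> measure lebesgue (L ` P m)" for m
  proof (rule card_integer_points_le)
    show "L ` P m \<in> lmeasurable"
      by (intro measurable_linear_image lin) (simp add: P_def)
    fix i k :: int and u :: "real ^ 2"
    assume ik: "(i, k) \<in> S m" and u: "of_int i \<le> u $ 1" "u $ 1 \<le> of_int i + 1" "of_int k \<le> u $ 2" "u $ 2 \<le> of_int k + 1"
    obtain s t where st: "s \<in> {0..real m}" "t \<in> {0..real m}"
      "\<bar>of_int i - (a * s + b * t)\<bar> \<le> C" "\<bar>of_int k - (c * s + d * t)\<bar> \<le> C"
      using ik by (auto simp: S_def)
    define r where "r = u $ 1 - (a * s + b * t)"
    define q where "q = u $ 2 - (c * s + d * t)"
    have rq: "\<bar>r\<bar> \<le> C + 1" "\<bar>q\<bar> \<le> C + 1"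
      using st(3,4) u unfolding r_def q_def by linarith+
    \<comment> \<open>Cramer's rule for the preimage \<open>(s', t')\<close> of \<open>u\<close>
      under \<open>L\<close>.\<close>
    define s' where "s' = s + (d * r - b * q) / D"
    define t' where "t' = t + (a * q - c * r) / D"
    have "\<bar>s' - s\<bar> \<le> R" "\<bar>t' - t\<bar> \<le> R"
      unfolding s'_def t'_def add_diff_cancel_left' by (intro Rb rq; simp)+
    then have "- R \<le> s'" "s' \<le> real m + R" "- R \<le> t'" "t' \<le> real m + R"
      using st(1,2) unfolding atLeastAtMost_iff by linarith+
    then have "vector [s', t'] \<in> P m"
      by (simp add: P_def mem_box_cart forall_2 vector_2)
    moreover have "L (vector [s', t']) = u"
    proof -
      have "a * (d * r - b * q) + b * (a * q - c * r) = r * D" "c * (d * r - b * q) + d * (a * q - c * r) = q * D"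
        by (simp_all add: D_def algebra_simps)
      then have "a * ((d * r - b * q) / D) + b * ((a * q - c * r) / D) = r"
        "c * ((d * r - b * q) / D) + d * ((a * q - c * r) / D) = q"
        using D0 by (simp_all add: add_divide_distrib[symmetric])
      then have "a * s' + b * t' = u $ 1" "c * s' + d * t' = u $ 2"
        by (simp_all add: s'_def t'_def distrib_left r_def q_def)
      then show ?thesis
        by (simp add: L_def vec_eq_iff forall_2 vector_2)
    qed
    ultimately show "u \<in> L ` P m"
      by blast
  qed
  have meas: "measure lebesgue (L ` P m) = \<bar>a * d - b * c\<bar> * (real m + 2 * R)\<^sup>2" for m
  proof -
    have "measure lebesgue (L ` P m) = \<bar>det (matrix L)\<bar> * measure lebesgue (P m)"
      by (intro measure_linear_image lin) (simp add: P_def)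
    also have "det (matrix L) = a * d - b * c"
      unfolding L_def by (rule det_matrix_2)
    also have "P m \<noteq> {}"
      using R by (simp add: P_def interval_ne_empty_cart)
    then have "measure lebesgue (P m) = (real m + 2 * R)\<^sup>2"
      unfolding P_def by (simp add: content_cbox_cart power2_eq_square add.commute)
    finally show ?thesis .
  qed
  show thesis
  proof
    \<comment> \<open>The square \<open>[-R, m + R]\<close> in each coordinate has side
      \<open>m + 2 R\<close>.\<close>
    show "2 * R \<ge> 0"
      using R by simp
  qed (use main meas in \<open>auto simp: S_def\<close>)
qed

section \<open>Finite pieces of lattice systems\<close>

text \<open>Indexing by integer coordinates in the basis \<open>v\<close>, \<open>w\<close> lets
  finite pieces of a system be cut out and counted in the integer plane.\<close>

definition lattice_block :: "nat \<Rightarrow> (nat \<Rightarrow> real \<times> real) \<Rightarrow> real \<times> real \<Rightarrow> real \<times> real \<Rightarrow> (int \<times> int) set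
    \<Rightarrow> (nat \<times> (real \<times> real)) set" where
  "lattice_block N x v w T = (\<lambda>(n, i, k). (n, x n + (of_int i *\<^sub>R v + of_int k *\<^sub>R w))) ` ({1..N} \<times> T)"

lemma lattice_blockE:
  assumes "i \<in> lattice_block N x v w T"
  obtains n a b where "n \<in> {1..N}" "(a, b) \<in> T" "i = (n, x n + (of_int a *\<^sub>R v + of_int b *\<^sub>R w))"
  using assms unfolding lattice_block_def by auto

lemma lattice_block_mono: "T \<subseteq> T' \<Longrightarrow> lattice_block N x v w T \<subseteq> lattice_block N x v w T'"
  unfolding lattice_block_def by blast

lemma union_index_eq_lattice_block: "union_index N x (lattice v w) = lattice_block N x v w UNIV"
proof (intro set_eqI iffI)
  fix i assume "i \<in> union_index N x (lattice v w)"
  then obtain n q where n: "n \<in> {1..N}" "q \<in> lattice v w" "i = (n, x n + q)"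
    unfolding union_index_iff by blast
  then obtain a b where "q = of_int a *\<^sub>R v + of_int b *\<^sub>R w"
    unfolding lattice_def by blast
  then show "i \<in> lattice_block N x v w UNIV"
    unfolding lattice_block_def using n by (intro image_eqI[of _ _ "(n, a, b)"]) auto
next
  fix i assume "i \<in> lattice_block N x v w UNIV"
  then obtain n a b where n: "n \<in> {1..N}" "i = (n, x n + (of_int a *\<^sub>R v + of_int b *\<^sub>R w))"
    by (rule lattice_blockE)
  moreover have "of_int a *\<^sub>R v + of_int b *\<^sub>R w \<in> lattice v w"
    unfolding lattice_def by blast
  ultimately show "i \<in> union_index N x (lattice v w)"
    unfolding union_index_iff by blast
qed

lemma det2_nonzero_imp_independent:
  assumes "det2 v w \<noteq> 0" "a *\<^sub>R v + b *\<^sub>R w = a' *\<^sub>R v + b' *\<^sub>R w"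
  shows "a = a' \<and> b = b'"
proof -
  have 1: "a * fst v + b * fst w = a' * fst v + b' * fst w"
    and 2: "a * snd v + b * snd w = a' * snd v + b' * snd w"
    using assms(2) by (auto simp: prod_eq_iff)
  have "(a - a') * det2 v w = (a * fst v + b * fst w - (a' * fst v + b' * fst w)) * snd w
      - (a * snd v + b * snd w - (a' * snd v + b' * snd w)) * fst w"
    by (simp add: det2_def algebra_simps)
  also have "\<dots> = 0"
    unfolding 1 2 by simp
  finally have A: "(a - a') * det2 v w = 0" .
  have "(b - b') * det2 v w = (a * snd v + b * snd w - (a' * snd v + b' * snd w)) * fst v
      - (a * fst v + b * fst w - (a' * fst v + b' * fst w)) * snd v"
    by (simp add: det2_def algebra_simps)
  also have "\<dots> = 0"
    unfolding 1 2 by simp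
  finally show ?thesis
    using assms(1) A by simp
qed

lemma det2_coordinates:
  assumes "det2 v w \<noteq> 0"
  shows "p = (det2 p w / det2 v w) *\<^sub>R v + (det2 v p / det2 v w) *\<^sub>R w"
proof -
  have "det2 v w * fst p = det2 p w * fst v + det2 v p * fst w"
    "det2 v w * snd p = det2 p w * snd v + det2 v p * snd w"
    by (simp_all add: det2_def algebra_simps)
  then show ?thesis
    using assms by (simp add: prod_eq_iff field_simps)
qed

text \<open>Independence of \<open>v\<close> and \<open>w\<close> separates the integer coordinates,
  and the label \<open>n\<close> separates the translates.\<close>

lemma card_lattice_block:
  assumes "det2 v w \<noteq> 0"
  shows "card (lattice_block N x v w T) = N * card T"
proof -
  have "i = i' \<and> k = k'" if "of_int i *\<^sub>R v + of_int k *\<^sub>R w = of_int i' *\<^sub>R v + of_int k' *\<^sub>R w"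
    for i k i' k' :: int
    using det2_nonzero_imp_independent[OF assms that] by simp
  then have "inj_on (\<lambda>(n, i, k). (n, x n + (of_int i *\<^sub>R v + of_int k *\<^sub>R w))) ({1..N} \<times> T)"
    by (auto intro!: inj_onI)
  then show ?thesis
    by (simp add: lattice_block_def card_image card_cartesian_product)
qed

text \<open>By compactness finitely many elements of the complete system suffice for all shifts in a fundamental
  domain of its lattice, and lattice translates of these serve for all other shifts.\<close>
lemma complete_sys_uniform_approx:
  fixes g :: "nat \<Rightarrow> real \<Rightarrow> complex"
  assumes gL2: "\<forall>n\<in>{1..N}. g n \<in> L2"
    and gL2': "\<forall>n\<in>{1..N'}. g' n \<in> L2"
    and K: "compact K" and "\<epsilon> > 0"
    and compl: "complete_sys (union_family g') (union_index N' x' (lattice v' w'))"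
  obtains R :: nat where "\<And>n z. n \<in> {1..N} \<Longrightarrow> z \<in> K \<Longrightarrow>
    \<exists>u\<in>fam_span (union_family g') (lattice_block N' x' v' w' ({- int R..int R} \<times> {- int R..int R})).
      l2norm (\<lambda>t. tf (g n) z t - u t) < \<epsilon>"
proof -
  define J where "J = (\<lambda>R::nat. lattice_block N' x' v' w' ({- int R..int R} \<times> {- int R..int R}))"
  have Jmono: "fam_span (union_family g') (J R) \<subseteq> fam_span (union_family g') (J R')" if "R \<le> R'" for R R'
    unfolding J_def using that by (intro fam_span_mono lattice_block_mono Sigma_mono) auto
  have L2': "u \<in> L2" if "u \<in> fam_span (union_family g') (J R)" for u R
  proof (rule fam_span_L2[OF that], rule union_family_L2)
    fix j assume "j \<in> J R"
    then show "j \<in> union_index N' x' (lattice v' w')"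
      unfolding union_index_eq_lattice_block J_def using lattice_block_mono[OF subset_UNIV] by blast
  qed (use gL2' in blast)
  have 1: "\<exists>R. \<exists>u\<in>fam_span (union_family g') (J R). l2norm (\<lambda>t. f t - u t) < \<epsilon> / 2" if f: "f \<in> L2" for f
  proof -
    obtain u where u: "u \<in> fam_span (union_family g') (union_index N' x' (lattice v' w'))"
        "l2norm (\<lambda>t. f t - u t) < \<epsilon> / 2"
      using compl f \<open>\<epsilon> > 0\<close> unfolding complete_sys_def by (meson half_gt_zero)
    then obtain F c where F: "finite F" "F \<subseteq> lattice_block N' x' v' w' UNIV"
        "u = (\<lambda>t. \<Sum>j\<in>F. c j * union_family g' j t)"
      unfolding fam_span_def union_index_eq_lattice_block by blast
    have "\<exists>R. F \<subseteq> J R"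
      using F(1,2)
    proof (induction F rule: finite_induct)
      case (insert j F)
      obtain R where R: "F \<subseteq> J R"
        using insert by auto
      obtain n i k where j: "n \<in> {1..N'}" "j = (n, x' n + (of_int i *\<^sub>R v' + of_int k *\<^sub>R w'))"
        using insert.prems by (auto elim: lattice_blockE)
      define R' where "R' = max R (nat (max \<bar>i\<bar> \<bar>k\<bar>))"
      have "j \<in> J R'"
        unfolding J_def lattice_block_def
        by (rule image_eqI[of _ _ "(n, i, k)"]) (use j in \<open>auto simp: R'_def\<close>)
      moreover have "J R \<subseteq> J R'"
        unfolding J_def by (intro lattice_block_mono Sigma_mono) (auto simp: R'_def)
      ultimately show ?case
        using R by blast
    qed simp
    then obtain R where "F \<subseteq> J R" ..
    then have "u \<in> fam_span (union_family g') (J R)"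
      unfolding F(3) using F(1) by (intro fam_spanI)
    then show ?thesis
      using u(2) by blast
  qed
  have 2: "\<exists>R. \<forall>z\<in>K. \<exists>u\<in>fam_span (union_family g') (J R). l2norm (\<lambda>t. tf (g n) z t - u t) < \<epsilon>"
    if n: "n \<in> {1..N}" for n
  proof -
    obtain Z where Z: "finite Z" "Z \<subseteq> K"
      "\<And>z. z \<in> K \<Longrightarrow> \<exists>z0\<in>Z. l2norm (\<lambda>t. tf (g n) z t - tf (g n) z0 t) < \<epsilon> / 2"
      using tf_compact_net[OF K bspec[OF gL2 n], of "\<epsilon> / 2"] \<open>\<epsilon> > 0\<close> by auto
    have "\<forall>z0. \<exists>R. \<exists>u\<in>fam_span (union_family g') (J R). l2norm (\<lambda>t. tf (g n) z0 t - u t) < \<epsilon> / 2"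
      using 1 gL2 n by blast
    then obtain \<rho> where \<rho>: "\<And>z0. \<exists>u\<in>fam_span (union_family g') (J (\<rho> z0)). l2norm (\<lambda>t. tf (g n) z0 t - u t) < \<epsilon> / 2"
      by metis
    \<comment> \<open>Half of \<open>\<epsilon>\<close> goes to the net and half to the
      approximation of its points; inserting 0 covers an empty net.\<close>
    define R where "R = Max (insert 0 (\<rho> ` Z))"
    have "\<exists>u\<in>fam_span (union_family g') (J R). l2norm (\<lambda>t. tf (g n) z t - u t) < \<epsilon>" if "z \<in> K" for z
    proof -
      obtain z0 where z0: "z0 \<in> Z" "l2norm (\<lambda>t. tf (g n) z t - tf (g n) z0 t) < \<epsilon> / 2"
        using Z(3) \<open>z \<in> K\<close> by blast
      obtain u where u: "u \<in> fam_span (union_family g') (J (\<rho> z0))" "l2norm (\<lambda>t. tf (g n) z0 t - u t) < \<epsilon> / 2"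
        using \<rho> by blast
      have "\<rho> z0 \<le> R"
        unfolding R_def using Z(1) z0(1) by (intro Max_ge) auto
      then have "u \<in> fam_span (union_family g') (J R)"
        using Jmono u(1) by blast
      moreover have "l2norm (\<lambda>t. tf (g n) z t - u t) < \<epsilon>"
        using l2norm_triangle_diff[of "tf (g n) z" "tf (g n) z0" u] bspec[OF gL2 n] L2'[OF u(1)] z0(2) u(2)
        by simp
      ultimately show ?thesis
        by blast
    qed
    then show ?thesis
      by blast
  qed
  then obtain \<rho> where \<rho>: "\<And>n. n \<in> {1..N} \<Longrightarrow> \<forall>z\<in>K. \<exists>u\<in>fam_span (union_family g') (J (\<rho> n)).
      l2norm (\<lambda>t. tf (g n) z t - u t) < \<epsilon>"
    by metis
  define R where "R = Max (insert 0 (\<rho> ` {1..N}))"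
  have "\<exists>u\<in>fam_span (union_family g') (J R). l2norm (\<lambda>t. tf (g n) z t - u t) < \<epsilon>" if "n \<in> {1..N}" "z \<in> K" for n z
  proof -
    have "\<rho> n \<le> R"
      unfolding R_def using that by (intro Max_ge) auto
    then show ?thesis
      using \<rho>[OF that(1)] that(2) Jmono by blast
  qed
  then show thesis
    using that unfolding J_def by blast
qed

text \<open>Each side is the number of system points per unit area of the time-frequency plane.
  Writing the first lattice in the basis of the second turns the comparison into counting in the
  integer plane, with the determinant of the change of basis as area factor.\<close>

lemma lattice_system_comparison:
  assumes det: "det2 v w \<noteq> 0" and det': "det2 v' w' \<noteq> 0"
    and gL2: "\<forall>n\<in>{1..N}. g n \<in> L2"
    and gL2': "\<forall>n\<in>{1..N'}. g' n \<in> L2"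
    and um: "uniformly_minimal_sys (union_family g) (union_index N x (lattice v w))"
    and compl: "complete_sys (union_family g') (union_index N' x' (lattice v' w'))"
  shows "real N / \<bar>det2 v w\<bar> \<le> real N' / \<bar>det2 v' w'\<bar>"
proof -
  obtain \<delta> where \<delta>: "\<delta> > 0" "\<And>i. i \<in> union_index N x (lattice v w) \<Longrightarrow>
      \<delta> \<le> dist_to_others (union_family g) (union_index N x (lattice v w)) i"
    using um unfolding uniformly_minimal_sys_def by blast
  \<comment> \<open>Cramer's rule: \<open>(a, c)\<close> and \<open>(b, d)\<close> are the
    coordinates of \<open>v\<close> and \<open>w\<close> in the basis \<open>v'\<close>,
    \<open>w'\<close>.\<close>
  define a b c d where "a = det2 v w' / det2 v' w'" and "b = det2 w w' / det2 v' w'"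
    and "c = det2 v' v / det2 v' w'" and "d = det2 v' w / det2 v' w'"
  have D: "a * d - b * c = det2 v w / det2 v' w'"
  proof -
    \<comment> \<open>The Pluecker relation for four vectors of the plane.\<close>
    have "det2 v w' * det2 v' w - det2 w w' * det2 v' v = det2 v w * det2 v' w'"
      by (simp add: det2_def algebra_simps)
    then show ?thesis
      using det' by (simp add: a_def b_def c_def d_def field_simps)
  qed
  have coord: "s *\<^sub>R v + t *\<^sub>R w = (a * s + b * t) *\<^sub>R v' + (c * s + d * t) *\<^sub>R w'" for s t
  proof -
    have "v = a *\<^sub>R v' + c *\<^sub>R w'" "w = b *\<^sub>R v' + d *\<^sub>R w'"
      unfolding a_def b_def c_def d_def by (rule det2_coordinates[OF det'])+
    then show ?thesis
      by (simp add: algebra_simps)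
  qed
  \<comment> \<open>The closed parallelogram is taken in order to be compact; it contains a
    fundamental domain of the second lattice.\<close>
  define K where "K = (\<lambda>(s, t). s *\<^sub>R v' + t *\<^sub>R w') ` ({0..1} \<times> {0..1 :: real})"
  have cK: "compact K"
    unfolding K_def split_def by (intro compact_continuous_image compact_Times continuous_intros) auto
  \<comment> \<open>The offset \<open>x n\<close> is absorbed in the generator, so that only lattice
    points remain to be reduced modulo the second lattice.\<close>
  define G where "G = (\<lambda>n. tf (g n) (x n))"
  have GL2: "\<forall>n\<in>{1..N}. G n \<in> L2"
    using gL2 by (simp add: G_def)
  have *: "real N * (1 - \<eta>) \<le> real N' * \<bar>a * d - b * c\<bar>" if \<eta>: "\<eta> > 0" for \<eta>
  proof -
    have pos: "\<eta> * \<delta> > 0"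
      using \<eta> \<delta>(1) by simp
    obtain R :: nat where R: "\<And>n z. n \<in> {1..N} \<Longrightarrow> z \<in> K \<Longrightarrow>
      \<exists>u\<in>fam_span (union_family g') (lattice_block N' x' v' w' ({- int R..int R} \<times> {- int R..int R})).
        l2norm (\<lambda>t. tf (G n) z t - u t) < \<eta> * \<delta>"
      by (rule complete_sys_uniform_approx[OF GL2 gL2' cK pos compl]) (rule that)
    \<comment> \<open>\<open>R\<close> accounts for the coordinates used by the approximation, 1 for
      the distance of a real coordinate from its floor.\<close>
    define C where "C = real R + 1"
    define S where "S = (\<lambda>m::nat. {(i::int, k::int). \<exists>s\<in>{0..real m}. \<exists>t\<in>{0..real m}.
      \<bar>of_int i - (a * s + b * t)\<bar> \<le> C \<and> \<bar>of_int k - (c * s + d * t)\<bar> \<le> C})"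
    obtain L where L: "L \<ge> 0" "\<And>m. finite (S m)" "\<And>m. real (card (S m)) \<le> \<bar>a * d - b * c\<bar> * (real m + L)\<^sup>2"
      using lattice_points_near_parallelogram[of a d b c C] D det det' unfolding S_def C_def by auto
    have cnt: "real N * (real m)\<^sup>2 * (1 - \<eta>) \<le> real N' * (\<bar>a * d - b * c\<bar> * (real m + L)\<^sup>2)" for m
    proof -
      define A where "A = lattice_block N x v w ({0..<int m} \<times> {0..<int m})"
      define B where "B = lattice_block N' x' v' w' (S m)"
      have sub: "A \<subseteq> union_index N x (lattice v w)" "B \<subseteq> union_index N' x' (lattice v' w')"
        unfolding union_index_eq_lattice_block A_def B_def by (intro lattice_block_mono subset_UNIV)+
      have "real (card A) * (1 - \<eta> * \<delta> / \<delta>) \<le> real (card B)"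
      proof (rule card_le_of_approx)
        show "finite A" "finite B"
          using L(2) by (simp_all add: A_def B_def lattice_block_def)
        show "union_family g i \<in> L2" if "i \<in> A" for i
          using sub(1) that union_family_L2[of N g i x "lattice v w"] gL2 by blast
        show "union_family g' i \<in> L2" if "i \<in> B" for i
          using sub(2) that union_family_L2[of N' g' i x' "lattice v' w'"] gL2' by blast
        \<comment> \<open>Passing to fewer competitors can only increase the distance.\<close>
        show "\<delta> \<le> dist_to_others (union_family g) A i" if "i \<in> A" for i
        proof (rule dist_to_others_ge)
          fix h assume "h \<in> fam_span (union_family g) (A - {i})"
          then have h: "h \<in> fam_span (union_family g) (union_index N x (lattice v w) - {i})"
            using fam_span_mono[of "A - {i}" "union_index N x (lattice v w) - {i}"] sub(1) by blast
          have "\<delta> \<le> dist_to_others (union_family g) (union_index N x (lattice v w)) i"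
            using \<delta>(2) sub(1) that by blast
          also have "\<dots> \<le> l2norm (\<lambda>t. union_family g i t - h t)"
            by (rule dist_to_others_le[OF h])
          finally show "\<delta> \<le> l2norm (\<lambda>t. union_family g i t - h t)" .
        qed
        show "\<exists>u\<in>fam_span (union_family g') B. l2norm (\<lambda>t. union_family g i t - u t) \<le> \<eta> * \<delta>" if i: "i \<in> A" for i
        proof -
          obtain n p q where n: "n \<in> {1..N}" and pq: "0 \<le> p" "p < int m" "0 \<le> q" "q < int m"
            and i_eq: "i = (n, x n + (of_int p *\<^sub>R v + of_int q *\<^sub>R w))"
            using i unfolding A_def by (rule lattice_blockE) (rule that, auto)
          define \<alpha> \<beta> where "\<alpha> = a * of_int p + b * of_int q" and "\<beta> = c * of_int p + d * of_int q"
          \<comment> \<open>Reduction modulo the second lattice: the integer parts give a lattice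
            vector \<open>r\<close>, the fractional parts a point \<open>z\<close> of
            \<open>K\<close>.\<close>
          define r where "r = of_int \<lfloor>\<alpha>\<rfloor> *\<^sub>R v' + of_int \<lfloor>\<beta>\<rfloor> *\<^sub>R w'"
          define z where "z = frac \<alpha> *\<^sub>R v' + frac \<beta> *\<^sub>R w'"
          have zr: "z + r = of_int p *\<^sub>R v + of_int q *\<^sub>R w"
            unfolding coord \<alpha>_def[symmetric] \<beta>_def[symmetric] by (simp add: z_def r_def frac_def algebra_simps)
          have "z \<in> K"
            unfolding K_def z_def by (rule image_eqI[of _ _ "(frac \<alpha>, frac \<beta>)"]) (auto intro: less_imp_le frac_lt_1)
          then obtain u where u: "u \<in> fam_span (union_family g') (lattice_block N' x' v' w' ({- int R..int R} \<times> {- int R..int R}))"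
            "l2norm (\<lambda>t. tf (G n) z t - u t) < \<eta> * \<delta>"
            using R n by blast
          \<comment> \<open>Adding \<open>r\<close> shifts the integer coordinates by the floors,
            which keeps them within \<open>C\<close> of the real coordinates \<open>\<alpha>\<close>
            and \<open>\<beta>\<close>.\<close>
          have "(\<lambda>(n, p). (n, p + r)) ` lattice_block N' x' v' w' ({- int R..int R} \<times> {- int R..int R}) \<subseteq> B"
          proof
            fix j assume "j \<in> (\<lambda>(n, p). (n, p + r)) ` lattice_block N' x' v' w' ({- int R..int R} \<times> {- int R..int R})"
            then obtain y where y: "y \<in> lattice_block N' x' v' w' ({- int R..int R} \<times> {- int R..int R})"
                "j = (\<lambda>(n, p). (n, p + r)) y"
              by blast
            obtain n' i' k' where y': "n' \<in> {1..N'}" "(i', k') \<in> {- int R..int R} \<times> {- int R..int R}"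
                "y = (n', x' n' + (of_int i' *\<^sub>R v' + of_int k' *\<^sub>R w'))"
              using lattice_blockE[OF y(1)] .
            then have j: "n' \<in> {1..N'}" "\<bar>i'\<bar> \<le> int R" "\<bar>k'\<bar> \<le> int R"
                "j = (n', x' n' + (of_int i' *\<^sub>R v' + of_int k' *\<^sub>R w') + r)"
              using y(2) by (auto simp: abs_le_iff)
            have "\<bar>of_int i' :: real\<bar> \<le> real R" "\<bar>of_int k' :: real\<bar> \<le> real R"
              using j(2,3) by linarith+
            then have "\<bar>of_int (i' + \<lfloor>\<alpha>\<rfloor>) - \<alpha>\<bar> \<le> C" "\<bar>of_int (k' + \<lfloor>\<beta>\<rfloor>) - \<beta>\<bar> \<le> C"
              unfolding C_def by linarith+
            moreover have "real_of_int p \<in> {0..real m}" "real_of_int q \<in> {0..real m}"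
              using pq by auto
            ultimately have "(i' + \<lfloor>\<alpha>\<rfloor>, k' + \<lfloor>\<beta>\<rfloor>) \<in> S m"
              unfolding S_def \<alpha>_def \<beta>_def by blast
            then show "j \<in> B"
              unfolding B_def lattice_block_def using j
              by (intro image_eqI[of _ _ "(n', i' + \<lfloor>\<alpha>\<rfloor>, k' + \<lfloor>\<beta>\<rfloor>)"]) (auto simp: r_def algebra_simps)
          qed
          then have ur: "tf u r \<in> fam_span (union_family g') B"
            using fam_span_union_family_tf[OF u(1), of r] fam_span_mono by blast
          have ur_norm: "l2norm (\<lambda>t. tf (tf (G n) z) r t - tf u r t) < \<eta> * \<delta>"
            using u(2) l2norm_tfshift[of "\<lambda>t. tf (G n) z t - u t" "fst r" "snd r"] by (simp add: tfshift_diff)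
          \<comment> \<open>The shifts by \<open>z\<close> and \<open>r\<close> reproduce the
            element \<open>i\<close> only up to the phase \<open>\<kappa>\<close>, which a scalar in
            the span of \<open>B\<close> removes.\<close>
          define \<kappa> where "\<kappa> = cis (- (2 * pi * snd z * fst r)) * cis (- (2 * pi * snd (x n) * fst (z + r)))"
          have \<kappa>: "cmod \<kappa> = 1" "\<kappa> \<noteq> 0"
            by (simp_all add: \<kappa>_def norm_mult)
          have "tf (tf (G n) z) r = (\<lambda>t. cis (- (2 * pi * snd z * fst r)) * tf (G n) (z + r) t)"
            by (rule tf_tf)
          also have "tf (G n) (z + r) = (\<lambda>t. cis (- (2 * pi * snd (x n) * fst (z + r))) * tf (g n) (x n + (z + r)) t)"
            unfolding G_def by (rule tf_tf)
          also have "tf (g n) (x n + (z + r)) = union_family g i"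
            by (simp only: i_eq union_family_def zr prod.case)
          finally have "tf (tf (G n) z) r = (\<lambda>t. \<kappa> * union_family g i t)"
            by (simp only: \<kappa>_def mult.assoc)
          then have "(\<lambda>t. tf (tf (G n) z) r t - tf u r t)
              = (\<lambda>t. \<kappa> * (union_family g i t - inverse \<kappa> * tf u r t))"
            using \<kappa>(2) by (simp add: right_diff_distrib mult.assoc[symmetric])
          then have "l2norm (\<lambda>t. union_family g i t - inverse \<kappa> * tf u r t) \<le> \<eta> * \<delta>"
            using ur_norm \<kappa>(1) by simp
          then show ?thesis
            by (intro bexI[of _ "\<lambda>t. inverse \<kappa> * tf u r t"] fam_span_cmult ur)
        qed
      qed (use \<delta> in auto)
      moreover have "real (card A) = real N * (real m)\<^sup>2"
        unfolding A_def card_lattice_block[OF det] by (simp add: card_cartesian_product power2_eq_square)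
      moreover have "real (card B) \<le> real N' * (\<bar>a * d - b * c\<bar> * (real m + L)\<^sup>2)"
        unfolding B_def card_lattice_block[OF det'] using L(3)[of m] by (simp add: mult_left_mono)
      ultimately show ?thesis
        using \<delta>(1) by simp
    qed
    \<comment> \<open>After division by the square of the side, the enlargement \<open>L\<close>
      enters as \<open>1 + L / m\<close>; the index \<open>Suc m\<close> avoids side 0.\<close>
    have "(\<lambda>m. real N' * (\<bar>a * d - b * c\<bar> * (1 + L * inverse (real (Suc m)))\<^sup>2)) \<longlonglongrightarrow> real N' * (\<bar>a * d - b * c\<bar> * (1 + L * 0)\<^sup>2)"
      by (intro tendsto_intros LIMSEQ_inverse_real_of_nat)
    moreover have "real N * (1 - \<eta>) \<le> real N' * (\<bar>a * d - b * c\<bar> * (1 + L * inverse (real (Suc m)))\<^sup>2)" for m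
    proof -
      have "real (Suc m) + L = real (Suc m) * (1 + L * inverse (real (Suc m)))"
        by (simp add: field_simps del: of_nat_Suc)
      then have "(real (Suc m) + L)\<^sup>2 = (real (Suc m))\<^sup>2 * (1 + L * inverse (real (Suc m)))\<^sup>2"
        by (simp only: power_mult_distrib)
      then have "(real (Suc m))\<^sup>2 * (real N * (1 - \<eta>))
          \<le> (real (Suc m))\<^sup>2 * (real N' * (\<bar>a * d - b * c\<bar> * (1 + L * inverse (real (Suc m)))\<^sup>2))"
        using cnt[of "Suc m"] by (simp only: ac_simps)
      then show ?thesis
        by (rule mult_left_le_imp_le) simp
    qed
    ultimately have "real N * (1 - \<eta>) \<le> real N' * (\<bar>a * d - b * c\<bar> * (1 + L * 0)\<^sup>2)"
      by (intro LIMSEQ_le_const) auto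
    then show ?thesis
      by simp
  qed
  have "real N \<le> real N' * \<bar>a * d - b * c\<bar>"
  proof (rule tendsto_upperbound)
    show "((\<lambda>\<eta>. real N * (1 - \<eta>)) \<longlongrightarrow> real N) (at_right 0)"
      by (auto intro!: tendsto_eq_intros)
    show "eventually (\<lambda>\<eta>. real N * (1 - \<eta>) \<le> real N' * \<bar>a * d - b * c\<bar>) (at_right 0)"
      using * eventually_at_right_less[of "0 :: real"] by (auto elim: eventually_mono)
  qed simp
  then show ?thesis
    unfolding D using det det' by (simp add: abs_divide field_simps)
qed

subsection \<open>The orthonormal basis with density one\<close>

definition unit_box :: "real \<Rightarrow> complex" where
  "unit_box = indicator {0..<1}"

abbreviation trig :: "int \<Rightarrow> real \<Rightarrow> complex" where
  "trig k t \<equiv> cis (2 * pi * of_int k * t)"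

lemma unit_box_L2: "unit_box \<in> L2"
proof (rule L2I_bound)
  show "integrable lborel (indicator {0..<1} :: real \<Rightarrow> real)"
    by (intro integrable_real_indicator) auto
qed (auto simp: unit_box_def indicator_def)

lemma tf_unit_box: "tf unit_box (of_int m, of_int k) = (\<lambda>t. trig k t * indicator {of_int m..<of_int m + 1} t)"
  by (simp add: tfshift_def unit_box_def indicator_def diff_less_eq add.commute)

text \<open>The antiderivative of the exponential has period one, and the missing endpoint
  \<open>a + 1\<close> is a null set.\<close>

lemma integral_trig_unit_interval:
  assumes "k \<noteq> 0"
  shows "(LINT t|lborel. trig k t * indicator {a..<a + 1} t) = 0"
proof -
  define \<omega> where "\<omega> = 2 * pi * of_int k"
  have \<omega>: "\<omega> \<noteq> 0"
    using assms by (simp add: \<omega>_def)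
  define F where "F = (\<lambda>t. exp (\<i> * of_real (\<omega> * t)) / (\<i> * of_real \<omega>))"
  have "(LINT t|lborel. trig k t * indicator {a..<a + 1} t) = (LINT t|lborel. indicator {a..a + 1} t *\<^sub>R exp (\<i> * of_real (\<omega> * t)))"
  proof (rule integral_cong_AE)
    show "AE t in lborel. trig k t * indicator {a..<a + 1} t = indicator {a..a + 1} t *\<^sub>R exp (\<i> * of_real (\<omega> * t))"
      using AE_lborel_singleton[of "a + 1"]
      by eventually_elim (auto simp: indicator_def \<omega>_def cis_conv_exp)
    have 1: "(\<lambda>t. exp (\<i> * of_real (\<omega> * t))) \<in> borel_measurable borel"
      by (intro borel_measurable_continuous_onI continuous_intros)
    then show "(\<lambda>t. indicator {a..a + 1} t *\<^sub>R exp (\<i> * of_real (\<omega> * t))) \<in> borel_measurable lborel"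
      by simp
    show "(\<lambda>t. trig k t * indicator {a..<a + 1} t) \<in> borel_measurable lborel"
      using 1 by (simp add: cis_conv_exp \<omega>_def)
  qed
  also have "\<dots> = F (a + 1) - F a"
  proof (rule integral_FTC_Icc)
    show "(F has_vector_derivative exp (\<i> * of_real (\<omega> * t))) (at t within {a..a + 1})" for t
    proof -
      have "((\<lambda>z. exp (\<i> * (of_real \<omega> * z)) / (\<i> * of_real \<omega>)) has_field_derivative
          exp (\<i> * (of_real \<omega> * of_real t))) (at (of_real t))"
        using \<omega> by (auto intro!: derivative_eq_intros simp: mult_ac)
      from has_vector_derivative_real_field[OF this]
      show ?thesis
        by (simp add: F_def)
    qed
    show "continuous_on {a..a + 1} (\<lambda>t. exp (\<i> * of_real (\<omega> * t)))"
      by (intro continuous_intros)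
  qed simp
  also have "F (a + 1) = F a"
  proof -
    have "exp (\<i> * of_real \<omega>) = 1"
      using cis_multiple_2pi[of "of_int k"] by (simp add: \<omega>_def cis_conv_exp[symmetric] del: of_real_mult)
    then show ?thesis
      by (simp add: F_def distrib_left exp_add)
  qed
  finally show ?thesis by simp
qed

text \<open>Boxes over distinct unit intervals are disjoint; over the same interval the product is
  the exponential of frequency \<open>k - k'\<close>, integrated over a period.\<close>

lemma unit_box_orthonormal:
  "l2ip (tf unit_box (of_int m, of_int k)) (tf unit_box (of_int m', of_int k')) = (if m = m' \<and> k = k' then 1 else 0)"
proof (cases "m = m'")
  case False
  have "indicator {of_int m..<of_int m + 1} t * indicator {of_int m'..<of_int m' + 1} t = (0 :: complex)" for t :: real
  proof (rule ccontr)
    assume "\<not> ?thesis"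
    then have "m = \<lfloor>t\<rfloor>" "m' = \<lfloor>t\<rfloor>"
      by (auto simp: indicator_def split: if_splits intro!: floor_unique[symmetric])
    then show False
      using False by simp
  qed
  then have "tf unit_box (of_int m, of_int k) t * cnj (tf unit_box (of_int m', of_int k') t) = 0" for t
    unfolding tf_unit_box by (auto simp: indicator_def split: if_splits)
  then have "l2ip (tf unit_box (of_int m, of_int k)) (tf unit_box (of_int m', of_int k')) = (LINT t|(lborel :: real measure). 0)"
    by (simp only: l2ip_def)
  then show ?thesis
    using False by simp
next
  case True
  have "tf unit_box (of_int m, of_int k) t * cnj (tf unit_box (of_int m', of_int k') t)
      = trig (k - k') t * indicator {of_int m..<of_int m + 1} t" for t
    unfolding tf_unit_box True by (simp add: indicator_def cis_cnj cis_mult algebra_simps)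
  then have "l2ip (tf unit_box (of_int m, of_int k)) (tf unit_box (of_int m', of_int k'))
      = (LINT t|lborel. trig (k - k') t * indicator {of_int m..<of_int m + 1} t)"
    by (simp only: l2ip_def)
  also have "\<dots> = (if k = k' then 1 else 0)"
  proof (cases "k = k'")
    case True
    have "(LINT t|lborel. indicator {real_of_int m..<of_int m + 1} t :: complex)
        = (LINT t|lborel. complex_of_real (indicator {real_of_int m..<of_int m + 1} t))"
      by (intro Bochner_Integration.integral_cong) (auto simp: indicator_def)
    also have "\<dots> = of_real (LINT t|lborel. indicator {real_of_int m..<of_int m + 1} t)"
      by (rule integral_complex_of_real)
    also have "\<dots> = 1"
      by simp
    finally have "(LINT t|lborel. indicator {real_of_int m..<of_int m + 1} t :: complex) = 1" .
    then show ?thesis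
      using True by simp
  next
    case False
    then show ?thesis
      using integral_trig_unit_interval[of "k - k'" "of_int m"] by simp
  qed
  finally show ?thesis
    using True by simp
qed

abbreviation box_system :: "nat \<times> (real \<times> real) \<Rightarrow> real \<Rightarrow> complex" where
  "box_system \<equiv> union_family (\<lambda>_. unit_box)"

abbreviation box_index :: "(nat \<times> (real \<times> real)) set" where
  "box_index \<equiv> union_index 1 (\<lambda>_. 0) (lattice (1, 0) (0, 1))"

lemma box_index_iff: "i \<in> box_index \<longleftrightarrow> (\<exists>m k :: int. i = (1, (of_int m, of_int k)))"
  unfolding union_index_iff lattice_def by auto

text \<open>Pairing the difference between a unit vector and a combination of the others with that
  unit vector gives 1 by orthogonality, so Cauchy-Schwarz bounds the distance below by 1.\<close>

lemma box_system_uniformly_minimal: "uniformly_minimal_sys box_system box_index"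
  unfolding uniformly_minimal_sys_def
proof (intro exI[of _ 1] conjI ballI)
  fix i assume "i \<in> box_index"
  then obtain m k where i: "i = (1, (of_int m, of_int k))"
    unfolding box_index_iff by blast
  have L2: "box_system j \<in> L2" for j
    using unit_box_L2 by (cases j) (simp add: union_family_def)
  have one: "l2ip (box_system i) (box_system i) = 1"
    using unit_box_orthonormal[of m k m k] by (simp add: i union_family_def)
  then have "complex_of_real ((l2norm (box_system i))\<^sup>2) = of_real 1"
    by (simp add: l2ip_self)
  then have norm1: "l2norm (box_system i) = 1"
    by (simp only: of_real_eq_iff power2_eq_1_iff) (use l2norm_nonneg[of "box_system i"] in linarith)
  show "1 \<le> dist_to_others box_system box_index i"
  proof (rule dist_to_others_ge)
    fix h assume h: "h \<in> fam_span box_system (box_index - {i})"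
    have hL2: "h \<in> L2"
      by (rule fam_span_L2[OF h L2])
    have "l2ip h (box_system i) = 0"
    proof (rule fam_span_orthogonal[OF h L2 L2])
      fix j assume j: "j \<in> box_index - {i}"
      then obtain m' k' where j': "j = (1, (of_int m', of_int k'))"
        using box_index_iff[of j] by blast
      then show "l2ip (box_system i) (box_system j) = 0"
        using j unit_box_orthonormal[of m k m' k'] i by (auto simp: union_family_def)
    qed
    then have "l2ip (\<lambda>t. box_system i t - h t) (box_system i) = 1"
      using one hL2 L2 by simp
    then show "1 \<le> l2norm (\<lambda>t. box_system i t - h t)"
      using l2ip_Cauchy_Schwarz[of "\<lambda>t. box_system i t - h t" "box_system i"] hL2 L2 norm1 by simp
  qed
qed simp

section \<open>Trigonometric polynomials and completeness of the box system\<close>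

text \<open>Frequencies add under multiplication; this is what turns polynomials in the coordinates
  of the circle into trigonometric polynomials.\<close>

lemma trig_span_mult:
  assumes "p \<in> fam_span trig UNIV" "q \<in> fam_span trig UNIV"
  shows "(\<lambda>t. p t * q t) \<in> fam_span trig UNIV"
  using assms(1)
proof (induction rule: fam_span_induct)
  case zero
  show ?case
    using fam_span_zero by simp
next
  case (add h k)
  then show ?case
    using fam_span_add by (simp add: distrib_right)
next
  case (base c j)
  show ?case
    using assms(2)
  proof (induction rule: fam_span_induct)
    case zero
    show ?case
      using fam_span_zero by simp
  next
    case (add h k)
    then show ?case
      using fam_span_add by (simp add: distrib_left)
  next
    case (base d l)
    have "(\<lambda>t. c * trig j t * (d * trig l t)) = (\<lambda>t. (c * d) * trig (j + l) t)"
      by (simp add: cis_mult[symmetric] distrib_left distrib_right mult_ac)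
    also have "\<dots> \<in> fam_span trig UNIV"
      by (intro fam_span_cmult fam_span_base) simp
    finally show ?case .
  qed
qed

lemma trig_span_polynomial:
  assumes "real_polynomial_function f"
  shows "(\<lambda>t. complex_of_real (f (cis (2 * pi * t)))) \<in> fam_span trig UNIV"
  using assms
proof (induction rule: real_polynomial_function.induct)
  case (linear f)
  \<comment> \<open>Coefficients from Euler's formulas: a real linear \<open>f\<close> takes the
    value \<open>cos \<theta> * f 1 + sin \<theta> * f \<i>\<close> at
    \<open>cis \<theta>\<close>.\<close>
  define \<alpha> where "\<alpha> = (of_real (f 1) - \<i> * of_real (f \<i>)) / 2"
  define \<beta> where "\<beta> = (of_real (f 1) + \<i> * of_real (f \<i>)) / 2"
  have "complex_of_real (f (cis (2 * pi * t))) = \<alpha> * trig 1 t + \<beta> * trig (- 1) t" for t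
  proof -
    have "cis (2 * pi * t) = cos (2 * pi * t) *\<^sub>R 1 + sin (2 * pi * t) *\<^sub>R \<i>"
      by (simp add: complex_eq_iff)
    then have "f (cis (2 * pi * t)) = cos (2 * pi * t) * f 1 + sin (2 * pi * t) * f \<i>"
      using linear by (simp add: bounded_linear.linear linear_add linear_scale)
    then show ?thesis
      by (simp add: \<alpha>_def \<beta>_def complex_eq_iff field_simps)
  qed
  then show ?case
    by (simp only:) (intro fam_span_add fam_span_cmult fam_span_base; simp)
next
  case (const c)
  have "(\<lambda>t. of_real c * trig 0 t) \<in> fam_span trig UNIV"
    by (intro fam_span_cmult fam_span_base) simp
  then show ?case
    by simp
next
  case (add f g)
  then show ?case
    using fam_span_add by simp
next
  case (mult f g)
  then show ?case
    using trig_span_mult by simp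
qed

text \<open>Equal values at the endpoints close the piece of \<open>h\<close> over the interval into
  a loop, that is, a continuous function on the circle, to which Stone-Weierstrass applies.\<close>

lemma trig_approx:
  assumes h: "continuous_on UNIV h" "h (of_int m) = 0" "h (of_int m + 1) = (0 :: complex)" and "\<eta> > 0"
  obtains p where "p \<in> fam_span trig UNIV"
    "\<And>t. of_int m \<le> t \<Longrightarrow> t < of_int m + 1 \<Longrightarrow> cmod (h t - p t) < \<eta>"
proof -
  define \<gamma> where "\<gamma> = (\<lambda>s. h (of_int m + s))"
  have "path \<gamma>"
    unfolding path_def \<gamma>_def by (intro continuous_on_compose2[OF h(1)] continuous_intros) auto
  \<comment> \<open>The constant homotopy is taken only for its consequence that
    \<open>\<gamma>\<close> descends continuously to the circle, including the point 1 where
    \<open>Arg2pi\<close> jumps.\<close>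
  then have "homotopic_loops UNIV \<gamma> \<gamma>"
    using h by (simp add: homotopic_loops_refl pathfinish_def pathstart_def \<gamma>_def)
  then have cont: "continuous_on (sphere 0 1) (\<gamma> \<circ> (\<lambda>z. Arg2pi z / (2 * pi)))"
    using homotopic_loops_imp_homotopic_circlemaps homotopic_with_imp_continuous by blast
  obtain P where P: "polynomial_function P"
    "\<forall>z\<in>sphere 0 1. cmod ((\<gamma> \<circ> (\<lambda>z. Arg2pi z / (2 * pi))) z - P z) < \<eta>"
    using Stone_Weierstrass_polynomial_function[OF compact_sphere cont \<open>\<eta> > 0\<close>] by blast
  define p where "p = (\<lambda>t. P (cis (2 * pi * t)))"
  have "real_polynomial_function (Re \<circ> P)" "real_polynomial_function (Im \<circ> P)"
    using P(1) bounded_linear_Re bounded_linear_Im unfolding polynomial_function_def by blast+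
  then have "(\<lambda>t. of_real ((Re \<circ> P) (cis (2 * pi * t))) + \<i> * of_real ((Im \<circ> P) (cis (2 * pi * t)))) \<in> fam_span trig UNIV"
    by (intro fam_span_add fam_span_cmult trig_span_polynomial)
  then have "p \<in> fam_span trig UNIV"
    by (simp add: p_def complex_eq[symmetric])
  moreover have "cmod (h t - p t) < \<eta>" if t: "of_int m \<le> t" "t < of_int m + 1" for t
  proof -
    have "cis (2 * pi * t) = cis (2 * pi * of_int m) * cis (2 * pi * (t - of_int m))"
      by (simp add: cis_mult algebra_simps)
    also have "cis (2 * pi * of_int m) = 1"
      by (rule cis_multiple_2pi) simp
    finally have "cis (2 * pi * t) = exp (\<i> * of_real (2 * pi * (t - of_int m)))"
      by (simp add: cis_conv_exp)
    then have "Arg2pi (cis (2 * pi * t)) = 2 * pi * (t - of_int m)"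
      using Arg2pi_exp[of "\<i> * of_real (2 * pi * (t - of_int m))"] t by simp
    then have "(\<gamma> \<circ> (\<lambda>z. Arg2pi z / (2 * pi))) (cis (2 * pi * t)) = h t"
      by (simp add: \<gamma>_def)
    then show ?thesis
      using P(2)[rule_format, of "cis (2 * pi * t)"] by (simp add: p_def)
  qed
  ultimately show thesis
    by (rule that)
qed

lemma trig_span_box_system:
  assumes "p \<in> fam_span trig UNIV"
  shows "(\<lambda>t. p t * indicator {of_int m..<of_int m + 1} t) \<in> fam_span box_system box_index"
  using assms
proof (induction rule: fam_span_induct)
  case zero
  show ?case
    using fam_span_zero by simp
next
  case (add h k)
  then show ?case
    using fam_span_add by (simp add: distrib_right)
next
  case (base c k)
  have "(\<lambda>t. c * box_system (1, (of_int m, of_int k)) t) \<in> fam_span box_system box_index"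
    by (intro fam_span_cmult fam_span_base) (use box_index_iff in blast)
  then show ?case
    using tf_unit_box[of m k] by (simp add: union_family_def mult.assoc)
qed

text \<open>The trigonometric approximation is uniform on each of the \<open>2 M\<close> unit
  intervals that carry \<open>h\<close>, and a small uniform error on a bounded set is small in the
  \<open>L2\<close> norm.\<close>

lemma box_system_complete: "complete_sys box_system box_index"
  unfolding complete_sys_def
proof (intro ballI allI impI)
  fix f :: "real \<Rightarrow> complex" and \<epsilon> :: real
  assume f: "f \<in> L2" and "\<epsilon> > 0"
  obtain h and M :: nat where h: "continuous_on UNIV h" "\<And>t. real M \<le> \<bar>t\<bar> \<Longrightarrow> h t = 0"
    "\<And>k :: int. h (of_int k) = 0" "l2norm (\<lambda>t. f t - h t) < \<epsilon> / 2"
    using L2_approx_continuous[OF f, of "\<epsilon> / 2"] \<open>\<epsilon> > 0\<close> by auto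
  \<comment> \<open>The squared error is at most \<open>2 M\<close> times the square of
    \<open>\<eta>\<close>. Bounding \<open>2 M\<close> by the square of \<open>2 M + 1\<close> gives
    the error \<open>\<epsilon> / 2\<close> without a square root, and the added 1 also keeps the
    denominator positive when \<open>M = 0\<close>.\<close>
  define \<eta> where "\<eta> = \<epsilon> / (2 * (2 * real M + 1))"
  have \<eta>: "\<eta> > 0"
    using \<open>\<epsilon> > 0\<close> by (simp add: \<eta>_def add_pos_nonneg)
  have "\<exists>p\<in>fam_span trig UNIV. \<forall>t. of_int m \<le> t \<longrightarrow> t < of_int m + 1 \<longrightarrow> cmod (h t - p t) < \<eta>" for m
  proof -
    have "h (of_int m + 1) = 0"
      using h(3)[of "m + 1"] by simp
    then show ?thesis
      using trig_approx[OF h(1) h(3) _ \<eta>] by metis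
  qed
  then obtain p where p: "\<And>m. p m \<in> fam_span trig UNIV"
    "\<And>m t. of_int m \<le> t \<Longrightarrow> t < of_int m + 1 \<Longrightarrow> cmod (h t - p m t) < \<eta>"
    by metis
  define u where "u = (\<lambda>t. \<Sum>m\<in>{- int M..<int M}. p m t * indicator {of_int m..<of_int m + 1} t)"
  have u: "u \<in> fam_span box_system box_index"
    unfolding u_def by (intro fam_span_sum trig_span_box_system p)
  have uL2: "u \<in> L2"
    using unit_box_L2 by (intro fam_span_L2[OF u]) (auto simp: union_family_def split: prod.split)
  have hL2: "h \<in> L2"
    by (rule continuous_compact_support_L2[OF h(1,2)])
  have bound: "(cmod (h t - u t))\<^sup>2 \<le> \<eta>\<^sup>2 * indicator {- real M..real M} t" for t
  proof -
    \<comment> \<open>The half-open unit intervals tile the line, so only the interval containing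
      \<open>t\<close> can contribute.\<close>
    have u_eq: "u t = (if \<lfloor>t\<rfloor> \<in> {- int M..<int M} then p \<lfloor>t\<rfloor> t else 0)"
    proof -
      have "u t = (\<Sum>m\<in>{- int M..<int M}. if \<lfloor>t\<rfloor> = m then p m t else 0)"
        unfolding u_def by (intro sum.cong) (auto simp: indicator_def floor_eq_iff)
      then show ?thesis
        by simp
    qed
    show ?thesis
    proof (cases "\<lfloor>t\<rfloor> \<in> {- int M..<int M}")
      case True
      then have "- real M \<le> t" "t \<le> real M"
        by (auto simp: le_floor_iff floor_less_iff)
      moreover have "cmod (h t - p \<lfloor>t\<rfloor> t) < \<eta>"
        by (rule p(2)) linarith+
      ultimately show ?thesis
        using True \<eta> by (simp add: u_eq power_mono less_imp_le)
    next
      case False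
      then have "real M \<le> \<bar>t\<bar>"
        by (auto simp: le_floor_iff floor_less_iff not_le not_less)
      then show ?thesis
        using h(2) False by (auto simp: u_eq)
    qed
  qed
  have int: "integrable lborel (\<lambda>t. \<eta>\<^sup>2 * indicator {- real M..real M} t)"
    by (intro integrable_mult_right integrable_real_indicator) (auto simp: emeasure_lborel_Icc_eq)
  have "(l2norm (\<lambda>t. h t - u t))\<^sup>2 \<le> (LINT t|lborel. \<eta>\<^sup>2 * indicator {- real M..real M} t)"
    unfolding l2norm_sq
    using hL2 uL2 int bound by (intro integral_mono L2D(2)) auto
  also have "\<dots> = \<eta>\<^sup>2 * (2 * real M)"
    by simp
  also have "\<dots> \<le> \<eta>\<^sup>2 * (2 * real M + 1)\<^sup>2"
    by (intro mult_left_mono) (auto simp: power2_eq_square algebra_simps)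
  also have "\<dots> = (\<eta> * (2 * real M + 1))\<^sup>2"
    by (simp add: power_mult_distrib)
  also have "\<eta> * (2 * real M + 1) = \<epsilon> / 2"
    unfolding \<eta>_def by (simp add: divide_simps)
  finally have "l2norm (\<lambda>t. h t - u t) \<le> \<epsilon> / 2"
    by (rule power2_le_imp_le) (use \<open>\<epsilon> > 0\<close> in simp)
  then have "l2norm (\<lambda>t. f t - u t) < \<epsilon>"
    using l2norm_triangle_diff[OF f hL2 uL2] h(4) by linarith
  then show "\<exists>u\<in>fam_span box_system box_index. l2norm (\<lambda>t. f t - u t) < \<epsilon>"
    using u by blast
qed

theorem theorem3:
  fixes v w :: "real \<times> real" and N :: nat
    and g :: "nat \<Rightarrow> real \<Rightarrow> complex" and x :: "nat \<Rightarrow> real \<times> real"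
  assumes indep: "det2 v w \<noteq> 0"
    and N: "N \<ge> 1"
    and gL2: "\<forall>n\<in>{1..N}. g n \<in> L2"
    and xdist: "inj_on x {1..N}"
  shows "(minimal_sys (union_family g) (union_index N x (lattice v w)) \<longrightarrow>
            uniformly_minimal_sys (union_family g) (union_index N x (lattice v w)) \<and>
            lattice_density v w \<le> 1 / real N)
       \<and> (complete_sys (union_family g) (union_index N x (lattice v w)) \<longrightarrow>
            lattice_density v w \<ge> 1 / real N)"
proof (intro conjI impI)
  have det_box: "det2 (1, 0) (0, 1) \<noteq> 0" "\<bar>det2 (1, 0) (0, 1)\<bar> = 1"
    by (simp_all add: det2_def)
  have box: "\<forall>n\<in>{1..1::nat}. unit_box \<in> L2"
    using unit_box_L2 by simp
  {
    assume "minimal_sys (union_family g) (union_index N x (lattice v w))"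
    then show um: "uniformly_minimal_sys (union_family g) (union_index N x (lattice v w))"
      by (rule minimal_imp_uniformly_minimal)
    \<comment> \<open>Here the given system is the uniformly minimal one and the box basis, of
      density one, the complete one.\<close>
    have "real N / \<bar>det2 v w\<bar> \<le> real 1 / \<bar>det2 (1, 0) (0, 1)\<bar>"
      by (rule lattice_system_comparison[OF indep det_box(1) gL2 box um box_system_complete])
    then show "lattice_density v w \<le> 1 / real N"
      using N indep det_box(2) by (simp add: lattice_density_def field_simps)
  next
    assume "complete_sys (union_family g) (union_index N x (lattice v w))"
    \<comment> \<open>The roles are exchanged: the box basis is the uniformly minimal system, the
      given one the complete system.\<close>
    then have "real 1 / \<bar>det2 (1, 0) (0, 1)\<bar> \<le> real N / \<bar>det2 v w\<bar>"
      by (rule lattice_system_comparison[OF det_box(1) indep box gL2 box_system_uniformly_minimal])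
    then show "1 / real N \<le> lattice_density v w"
      using N indep det_box(2) by (simp add: lattice_density_def field_simps)
  }
qed

end
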